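(* Let $r\ge1$ and $n\ge2$ be integers and let $E\in\mathcal{M}_X(r)$. The holomorphic connection on the line bundle $\det J^{n-1}(\mathbb{L}^{1-n})=\bigwedge^n J^{n-1}(\mathbb{L}^{1-n})$ (which is isomorphic to $\mathcal{O}_X$) induced by the connection $\mathcal{D}(E)$ on $J^{n-1}(\mathbb{L}^{1-n})$ is the trivial connection, i.e. the unique holomorphic connection on $\det J^{n-1}(\mathbb{L}^{1-n})$ with trivial monodromy.
   Context: Setting. $X$ is a compact connected Riemann surface of genus $g\ge2$, $K_X$ its holomorphic cotangent bundle, $TX$ its holomorphic tangent bundle. $\mathbb{L}$ is a fixed theta characteristic: a holomorphic line bundle with a fixed isomorphism $\mathbb{L}\otimes\mathbb{L}=K_X$. For $k\ge1$, $\mathbb{L}^k=\mathbb{L}^{\otimes k}$ and $\mathbb{L}^{-k}=(\mathbb{L}^{k})^*$. $\mathcal{M}_X(r)$ is the moduli space of stable vector bundles $E$ on $X$ of rank $r$ and degree $0$ with $H^0(X,E\otimes\mathbb{L})=0$. $p_1,p_2:X\times X\to X$ are the projections, $\Delta\subset X\times X$ is the reduced diagonal, identified with $X$ by $x\mapsto(x,x)$; $k\Delta$ denotes the $(k-1)$-st order infinitesimal neighbourhood of $\Delta$ (the subscheme defined by $\mathcal{O}_{X\times X}(-k\Delta)$). The adjunction formula identifies $\mathcal{O}_{X\times X}(-\Delta)|_\Delta=K_X$ (convention: $p_2^*h-p_1^*h\mapsto dh$) and $\mathcal{O}_{X\times X}(\Delta)|_\Delta=TX$. Hence $(p_1^*\mathbb{L}\otimes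 p_2^*\mathbb{L}\otimes\mathcal{O}_{X\times X}(\Delta))|_\Delta=K_X\otimes TX=\mathcal{O}_X$ and $(p_1^*(E\otimes\mathbb{L})\otimes p_2^*(E^*\otimes\mathbb{L})\otimes\mathcal{O}_{X\times X}(\Delta))|_\Delta=\mathrm{End}(E)$. The section $\mathcal{A}_E$. For $E\in\mathcal{M}_X(r)$ there is a unique $\mathcal{A}_E\in H^0(X\times X,\ p_1^*(E\otimes\mathbb{L})\otimes p_2^*(E^*\otimes\mathbb{L})\otimes\mathcal{O}_{X\times X}(\Delta))$ whose restriction to $\Delta$ is $\mathrm{Id}_E$. Jets and differential operators. $J^d(V)=p_{1*}(p_2^*V/(p_2^*V\otimes\mathcal{O}_{X\times X}(-(d+1)\Delta)))$ is the $d$-th jet bundle of $V$, and holomorphic differential operators of order $d$ from $V$ to $W$ are sections of $\mathrm{Diff}^d_X(V,W)=\mathrm{Hom}(J^d(V),W)$. They are identified with sections of $p_1^*W\otimes p_2^*(V^*\otimes K_X)\otimes\mathcal{O}_{X\times X}((d+1)\Delta)$ over $(d+1)\Delta$: a section $\kappa$ corresponds to the operator $s\mapsto \mathrm{Res}_{w=z}\langle\kappa(z,w),s(w)\rangle$ (residue in the second variable $w$ along the diagonal). The symbol of the operator is the restriction of $\kappa$ to $\Delta$, a section of $\mathrm{Hom}(V,W)\otimes (TX)^{\otimes d}$. The section $\delta$. The de Rham operator $d:\mathcal{O}_X\to K_X$ corresponds to a section $d_1$ of $p_1^*K_X\otimes p_2^*K_X\otimes\mathcal{O}_{X\times X}(2\Delta)$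 over $2\Delta$. $\delta$ is the unique section of $p_1^*\mathbb{L}\otimes p_2^*\mathbb{L}\otimes\mathcal{O}_{X\times X}(\Delta)$ over $2\Delta$ with $\delta\otimes\delta=d_1$ and $\delta|_\Delta=1$. The connection $D^E$. Let $\Phi_E\in H^0(2\Delta,p_1^*E\otimes p_2^*E^* )$ be the unique section with $\mathcal{A}_E|_{2\Delta}=\Phi_E\otimes\delta$; then $\Phi_E|_\Delta=\mathrm{Id}_E$. For a local holomorphic section $s$ of $E$, contract $\Phi_E$ with $p_2^*s$ to get a section $\widetilde{s}$ of $p_1^*E$ over $2\Delta$, and set $D^E(s)=\widetilde{s}-(p_1^*s)|_{2\Delta}$, a section of $E\otimes K_X$. $D^E$ is a holomorphic (hence flat) connection on $E$. The section $\widehat{\beta}_E$. Let $\mathcal{U}\subset X\times X$ be an open neighbourhood of $\Delta$ admitting a deformation retraction to $\Delta$, and $q_i=p_i|_{\mathcal{U}}$. There is a unique holomorphic isomorphism $f:q_1^*E\to q_2^*E$ over $\mathcal{U}$ which restricts to the identity of $E$ on $\Delta$ and takes the connection $q_1^*D^E$ to $q_2^*D^E$. Using $f$ to replace the factor $p_2^*E^*$ by $p_1^*E^*$, $\mathcal{A}_E|_{\mathcal{U}}$ becomes a section $\mathcal{A}'_E$ of $p_1^*(E\otimes E^*\otimes\mathbb{L})\otimes p_2^*\mathbb{L}\otimes\mathcal{O}_{X\times X}(\Delta)$ over $\mathcal{U}$. Applying $tr:E\otimes E^*=\mathrm{End}(E)\to\mathcal{O}_X$, $B\mapsto\frac1r\mathrm{trace}(B)$,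 gives $\widehat{\beta}_E\in H^0(\mathcal{U},p_1^*\mathbb{L}\otimes p_2^*\mathbb{L}\otimes\mathcal{O}_{X\times X}(\Delta))$. Jet sequences. With $V=\mathbb{L}^{1-n}$ (so $V\otimes K_X^{\otimes n}=\mathbb{L}^{n+1}$ and $V^*\otimes K_X=\mathbb{L}^{n+1}$), there are the natural exact sequences $0\to\mathbb{L}^{n+1}\xrightarrow{\iota_1}J^n(V)\xrightarrow{\psi_1}J^{n-1}(V)\to0$ and $0\to J^{n-1}(V)\otimes K_X\xrightarrow{\iota_2}J^1(J^{n-1}(V))\xrightarrow{\psi_2}J^{n-1}(V)\to0$, with inclusions coming from $\mathcal{O}_{X\times X}(-k\Delta)|_\Delta=K_X^{\otimes k}$, and the natural injective homomorphism $\mathbf{h}:J^n(V)\to J^1(J^{n-1}(V))$ (sending the $n$-jet of $s$ to the $1$-jet of the section $j^{n-1}s$), which satisfies $\psi_2\circ\mathbf{h}=\psi_1$. The connection $\mathcal{D}(E)$. The restriction $\beta_E^n:=(\widehat{\beta}_E)^{\otimes(n+1)}|_{(n+1)\Delta}$ is a holomorphic differential operator of order $n$ from $\mathbb{L}^{1-n}$ to $\mathbb{L}^{n+1}$ with symbol $1$, i.e. a homomorphism $\rho:J^n(\mathbb{L}^{1-n})\to\mathbb{L}^{n+1}$ with $\rho\circ\iota_1=\mathrm{Id}$. Let $\mathcal{D}_1:J^{n-1}(\mathbb{L}^{1-n})\to J^n(\mathbb{L}^{1-n})$ be the unique homomorphism with $\rho\circ\mathcal{D}_1=0$, $\psi_1\circ\mathcal{D}_1=\mathrm{Id}$;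 put $\mathcal{D}_2=\mathbf{h}\circ\mathcal{D}_1$, which satisfies $\psi_2\circ\mathcal{D}_2=\mathrm{Id}$; and let $\mathcal{D}(E):J^1(J^{n-1}(\mathbb{L}^{1-n}))\to J^{n-1}(\mathbb{L}^{1-n})\otimes K_X$ be the unique homomorphism with $\mathcal{D}(E)\circ\mathcal{D}_2=0$ and $\mathcal{D}(E)\circ\iota_2=\mathrm{Id}$. Viewed as a first-order differential operator, $\mathcal{D}(E)$ is a holomorphic connection on $J^{n-1}(\mathbb{L}^{1-n})$. Since $\mathbb{L}\otimes\mathbb{L}=K_X$, one has $\det J^{n-1}(\mathbb{L}^{1-n})=\mathcal{O}_X$; this line bundle has a unique holomorphic connection with trivial monodromy, called the trivial connection. *)

theory Defs
  imports
    "HOL-Complex_Analysis.Complex_Analysis"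
    "HOL-Homology.Homology"
    "Jordan_Normal_Form.Matrix"
    "Jordan_Normal_Form.Determinant"
begin

unbundle no vec_syntax

section \<open>Riemann surfaces\<close>

text \<open>
  The points of the surface are the elements of the type \<open>'a\<close>, and \<open>Idx\<close> indexes a holomorphic
  atlas with domains \<open>Dom i\<close> and coordinate functions \<open>crd i\<close>. The atlas need not be maximal.
\<close>

record ('a, 'i) rsurface =
  Idx :: "'i set"
  Dom :: "'i \<Rightarrow> 'a set"
  crd :: "'i \<Rightarrow> 'a \<Rightarrow> complex"

definition cinv :: "('a, 'i) rsurface \<Rightarrow> 'i \<Rightarrow> complex \<Rightarrow> 'a" where
  "cinv X i = inv_into (Dom X i) (crd X i)"

definition riemann_surface :: "('a::t2_space, 'i) rsurface \<Rightarrow> bool" where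
  "riemann_surface X \<longleftrightarrow>
     connected (UNIV :: 'a set) \<and>
     (\<Union>i\<in>Idx X. Dom X i) = UNIV \<and>
     (\<forall>i\<in>Idx X. open (Dom X i) \<and> open (crd X i ` Dom X i) \<and>
        homeomorphism (Dom X i) (crd X i ` Dom X i) (crd X i) (cinv X i)) \<and>
     (\<forall>i\<in>Idx X. \<forall>j\<in>Idx X. (crd X j \<circ> cinv X i) holomorphic_on crd X i ` (Dom X i \<inter> Dom X j))"

definition compact_riemann_surface :: "('a::t2_space, 'i) rsurface \<Rightarrow> bool" where
  "compact_riemann_surface X \<longleftrightarrow> riemann_surface X \<and> compact (UNIV :: 'a set)"

text \<open>The genus \<open>g\<close> of a compact surface: the first integral homology is free of rank \<open>2 g\<close>.\<close>

definition has_genus :: "('a::t2_space, 'i) rsurface \<Rightarrow> nat \<Rightarrow> bool" where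
  "has_genus X g \<longleftrightarrow>
     homology_group 1 (euclidean :: 'a topology) \<cong> free_Abelian_group {..<2 * g}"

definition holo_on :: "('a::t2_space, 'i) rsurface \<Rightarrow> 'a set \<Rightarrow> ('a \<Rightarrow> complex) \<Rightarrow> bool" where
  "holo_on X S f \<longleftrightarrow> (\<forall>i\<in>Idx X. (f \<circ> cinv X i) holomorphic_on crd X i ` (S \<inter> Dom X i))"

text \<open>
  Holomorphic functions on an open subset \<open>W\<close> of \<open>X \<times> X\<close>: complex differentiable in the
  coordinates, i.e. the total derivative exists and is complex linear.
\<close>

definition holo2_on :: "('a::t2_space, 'i) rsurface \<Rightarrow> ('a \<times> 'a) set \<Rightarrow> ('a \<times> 'a \<Rightarrow> complex) \<Rightarrow> bool"
where
  "holo2_on X W f \<longleftrightarrow>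
     (\<forall>i\<in>Idx X. \<forall>j\<in>Idx X. \<forall>x y. x \<in> Dom X i \<and> y \<in> Dom X j \<and> (x, y) \<in> W \<longrightarrow>
        (\<exists>a b. ((\<lambda>(z, w). f (cinv X i z, cinv X j w)) has_derivative (\<lambda>(h, k). a * h + b * k))
                 (at (crd X i x, crd X j y))))"

text \<open>The \<open>k\<close>-th Taylor coefficient of \<open>f\<close> at \<open>x\<close> with respect to the coordinate \<open>crd X i\<close>.\<close>

definition tcoeff :: "('a, 'i) rsurface \<Rightarrow> 'i \<Rightarrow> 'a \<Rightarrow> nat \<Rightarrow> ('a \<Rightarrow> complex) \<Rightarrow> complex" where
  "tcoeff X i x k f = (deriv ^^ k) (f \<circ> cinv X i) (crd X i x) / fact k"

section \<open>Holomorphic vector bundles\<close>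

text \<open>
  A bundle is given by its transition matrices with respect to the atlas: the components \<open>s i\<close> of a
  section \<open>s\<close> in the frames over the sets \<open>Dom X i\<close> satisfy \<open>s i x = G i j x *\<^sub>v s j x\<close>.
  As holomorphic vector bundles on non-compact Riemann surfaces are trivial, every holomorphic
  vector bundle on \<open>X\<close> arises in this way from any given atlas whose domains are not all of \<open>X\<close>,
  and the latter holds for every atlas of a compact surface.
\<close>

type_synonym ('a, 'i) vbundle = "'i \<Rightarrow> 'i \<Rightarrow> 'a \<Rightarrow> complex mat"

definition holo_bundle :: "('a::t2_space, 'i) rsurface \<Rightarrow> nat \<Rightarrow> ('a, 'i) vbundle \<Rightarrow> bool" where
  "holo_bundle X m G \<longleftrightarrow>
     (\<forall>i\<in>Idx X. \<forall>j\<in>Idx X. \<forall>x\<in>Dom X i \<inter> Dom X j. G i j x \<in> carrier_mat m m) \<and>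
     (\<forall>i\<in>Idx X. \<forall>j\<in>Idx X. \<forall>a<m. \<forall>b<m. holo_on X (Dom X i \<inter> Dom X j) (\<lambda>x. G i j x $$ (a, b))) \<and>
     (\<forall>i\<in>Idx X. \<forall>x\<in>Dom X i. G i i x = 1\<^sub>m m) \<and>
     (\<forall>i\<in>Idx X. \<forall>j\<in>Idx X. \<forall>k\<in>Idx X. \<forall>x\<in>Dom X i \<inter> Dom X j \<inter> Dom X k.
        G i j x * G j k x = G i k x)"

text \<open>Homomorphisms from the bundle \<open>G\<close> of rank \<open>p\<close> to the bundle \<open>H\<close> of rank \<open>q\<close>.\<close>

definition bundle_hom :: "('a::t2_space, 'i) rsurface \<Rightarrow> nat \<Rightarrow> nat \<Rightarrow>
    ('a, 'i) vbundle \<Rightarrow> ('a, 'i) vbundle \<Rightarrow> ('i \<Rightarrow> 'a \<Rightarrow> complex mat) \<Rightarrow> bool" where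
  "bundle_hom X p q G H \<phi> \<longleftrightarrow>
     (\<forall>i\<in>Idx X. \<forall>x\<in>Dom X i. \<phi> i x \<in> carrier_mat q p) \<and>
     (\<forall>i\<in>Idx X. \<forall>a<q. \<forall>b<p. holo_on X (Dom X i) (\<lambda>x. \<phi> i x $$ (a, b))) \<and>
     (\<forall>i\<in>Idx X. \<forall>j\<in>Idx X. \<forall>x\<in>Dom X i \<inter> Dom X j. \<phi> i x * G i j x = H i j x * \<phi> j x)"

definition holo_section :: "('a::t2_space, 'i) rsurface \<Rightarrow> nat \<Rightarrow> ('a, 'i) vbundle \<Rightarrow> 'a set \<Rightarrow>
    ('i \<Rightarrow> 'a \<Rightarrow> complex Matrix.vec) \<Rightarrow> bool" where
  "holo_section X m G S s \<longleftrightarrow>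
     (\<forall>i\<in>Idx X. \<forall>x\<in>S \<inter> Dom X i. s i x \<in> carrier_vec m) \<and>
     (\<forall>i\<in>Idx X. \<forall>a<m. holo_on X (S \<inter> Dom X i) (\<lambda>x. s i x $ a)) \<and>
     (\<forall>i\<in>Idx X. \<forall>j\<in>Idx X. \<forall>x\<in>S \<inter> Dom X i \<inter> Dom X j. s i x = G i j x *\<^sub>v s j x)"

text \<open>Local sections over an open set \<open>S \<subseteq> Dom X i\<close>, in the \<open>i\<close>-th frame.\<close>

definition local_section :: "('a::t2_space, 'i) rsurface \<Rightarrow> 'i \<Rightarrow> nat \<Rightarrow> 'a set \<Rightarrow>
    ('a \<Rightarrow> complex Matrix.vec) \<Rightarrow> bool" where
  "local_section X i m S s \<longleftrightarrow>
     open S \<and> S \<subseteq> Dom X i \<and> (\<forall>x\<in>S. s x \<in> carrier_vec m) \<and> (\<forall>a<m. holo_on X S (\<lambda>x. s x $ a))"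

text \<open>Line bundles are given by scalar cocycles.\<close>

type_synonym ('a, 'i) line_cocycle = "'i \<Rightarrow> 'i \<Rightarrow> 'a \<Rightarrow> complex"

definition scalar :: "complex \<Rightarrow> complex mat" where
  "scalar c = Matrix.mat 1 1 (\<lambda>_. c)"

definition lpow :: "('a, 'i) line_cocycle \<Rightarrow> int \<Rightarrow> ('a, 'i) vbundle" where
  "lpow l k = (\<lambda>i j x. scalar (l i j x powi k))"

definition twist :: "('a, 'i) vbundle \<Rightarrow> ('a, 'i) line_cocycle \<Rightarrow> int \<Rightarrow> ('a, 'i) vbundle" where
  "twist G l k = (\<lambda>i j x. (l i j x powi k) \<cdot>\<^sub>m G i j x)"

definition det_bundle :: "('a, 'i) vbundle \<Rightarrow> ('a, 'i) vbundle" where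
  "det_bundle G = (\<lambda>i j x. scalar (Determinant.det (G i j x)))"

text \<open>The cocycle of the cotangent bundle in the frames \<open>dz\<^sub>i\<close>, i.e. \<open>dz\<^sub>j/dz\<^sub>i\<close>.\<close>

definition canon :: "('a, 'i) rsurface \<Rightarrow> ('a, 'i) line_cocycle" where
  "canon X = (\<lambda>i j x. tcoeff X i x 1 (crd X j))"

text \<open>
  A theta characteristic: a line bundle \<open>l\<close> and an isomorphism of its square with the cotangent
  bundle, which over \<open>Dom X i\<close> maps the square of the frame of \<open>l\<close> to \<open>\<theta> i dz\<^sub>i\<close>.
\<close>

definition theta_char :: "('a::t2_space, 'i) rsurface \<Rightarrow> ('a, 'i) line_cocycle \<Rightarrow>
    ('i \<Rightarrow> 'a \<Rightarrow> complex) \<Rightarrow> bool" where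
  "theta_char X l \<theta> \<longleftrightarrow>
     holo_bundle X 1 (lpow l 1) \<and>
     bundle_hom X 1 1 (lpow l 2) (lpow (canon X) 1) (\<lambda>i x. scalar (\<theta> i x)) \<and>
     (\<forall>i\<in>Idx X. \<forall>x\<in>Dom X i. \<theta> i x \<noteq> 0)"

section \<open>Degree, stability and the moduli space\<close>

text \<open>
  The degree of a bundle is the degree of the divisor of a nonzero meromorphic section \<open>\<sigma>\<close> of its
  determinant; \<open>P\<close> is a finite set containing the poles.
\<close>

definition has_degree :: "('a::t2_space, 'i) rsurface \<Rightarrow> ('a, 'i) vbundle \<Rightarrow> int \<Rightarrow> bool" where
  "has_degree X G d \<longleftrightarrow>
     (\<exists>P \<sigma> ord. finite P \<and>
        (\<forall>i\<in>Idx X. (\<sigma> i \<circ> cinv X i) meromorphic_on crd X i ` Dom X i) \<and>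
        (\<forall>i\<in>Idx X. holo_on X (Dom X i - P) (\<sigma> i)) \<and>
        (\<forall>i\<in>Idx X. \<forall>j\<in>Idx X. \<forall>x\<in>Dom X i \<inter> Dom X j - P.
           \<sigma> i x = Determinant.det (G i j x) * \<sigma> j x) \<and>
        (\<exists>i\<in>Idx X. \<exists>x\<in>Dom X i - P. \<sigma> i x \<noteq> 0) \<and>
        (\<forall>i\<in>Idx X. \<forall>x\<in>Dom X i. ord x = zorder (\<sigma> i \<circ> cinv X i) (crd X i x)) \<and>
        finite {x. ord x \<noteq> 0} \<and> d = (\<Sum>x | ord x \<noteq> 0. ord x))"

text \<open>Proper holomorphic subbundles are images of fibrewise injective homomorphisms.\<close>

definition stable_bundle :: "('a::t2_space, 'i) rsurface \<Rightarrow> nat \<Rightarrow> ('a, 'i) vbundle \<Rightarrow> bool" where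
  "stable_bundle X r E \<longleftrightarrow>
     (\<forall>k F \<phi> dF dE. 0 < k \<and> k < r \<and> holo_bundle X k F \<and> bundle_hom X k r F E \<phi> \<and>
        (\<forall>i\<in>Idx X. \<forall>x\<in>Dom X i. \<forall>v\<in>carrier_vec k. \<phi> i x *\<^sub>v v = 0\<^sub>v r \<longrightarrow> v = 0\<^sub>v k) \<and>
        has_degree X F dF \<and> has_degree X E dE \<longrightarrow>
        real_of_int dF / real k < real_of_int dE / real r)"

definition in_moduli :: "('a::t2_space, 'i) rsurface \<Rightarrow> ('a, 'i) line_cocycle \<Rightarrow> nat \<Rightarrow>
    ('a, 'i) vbundle \<Rightarrow> bool" where
  "in_moduli X l r E \<longleftrightarrow>
     holo_bundle X r E \<and> has_degree X E 0 \<and> stable_bundle X r E \<and>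
     (\<forall>s. holo_section X r (twist E l 1) UNIV s \<longrightarrow>
        (\<forall>i\<in>Idx X. \<forall>x\<in>Dom X i. s i x = 0\<^sub>v r))"

section \<open>Jets and connections\<close>

text \<open>
  The fibre of \<open>J\<^sup>d(G)\<close> at \<open>x\<close>, \<open>G\<close> of rank \<open>m\<close>, has the coordinates \<open>c\<^sub>k \<in> \<complex>\<^sup>m\<close>, \<open>k \<le> d\<close>, of the jet
  of \<open>y \<mapsto> \<Sum>k. (crd X i y - crd X i x)\<^sup>k c\<^sub>k\<close>; the entry \<open>a\<close> of \<open>c\<^sub>k\<close> is stored at position \<open>k * m + a\<close>.
\<close>

definition jet :: "('a, 'i) rsurface \<Rightarrow> 'i \<Rightarrow> nat \<Rightarrow> nat \<Rightarrow> ('a \<Rightarrow> complex Matrix.vec) \<Rightarrow> 'a \<Rightarrow>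
    complex Matrix.vec" where
  "jet X i d m s x = Matrix.vec ((d + 1) * m) (\<lambda>p. tcoeff X i x (p div m) (\<lambda>y. s y $ (p mod m)))"

definition jet_bundle :: "('a, 'i) rsurface \<Rightarrow> nat \<Rightarrow> nat \<Rightarrow> ('a, 'i) vbundle \<Rightarrow> ('a, 'i) vbundle" where
  "jet_bundle X d m G = (\<lambda>i j x. Matrix.mat ((d + 1) * m) ((d + 1) * m) (\<lambda>(p, q).
     tcoeff X i x (p div m)
       (\<lambda>y. G i j y $$ (p mod m, q mod m) * (crd X j y - crd X j x) ^ (q div m))))"

text \<open>
  The truncation \<open>J\<^sup>d(G) \<rightarrow> J\<^sup>d\<^sup>-\<^sup>1(G)\<close>, and the inclusion of \<open>G \<otimes> K\<^sup>d\<close> into \<open>J\<^sup>d(G)\<close>, under which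
  \<open>dz\<^sup>d\<close> corresponds to \<open>(w - z)\<^sup>d\<close>.
\<close>

definition jet_trunc :: "nat \<Rightarrow> nat \<Rightarrow> complex mat" where
  "jet_trunc d m = Matrix.mat (d * m) ((d + 1) * m) (\<lambda>(p, q). if p = q then 1 else 0)"

definition jet_incl :: "nat \<Rightarrow> nat \<Rightarrow> complex mat" where
  "jet_incl d m = Matrix.mat ((d + 1) * m) m (\<lambda>(p, q). if p = d * m + q then 1 else 0)"

text \<open>The natural homomorphism \<open>J\<^sup>n(V) \<rightarrow> J\<^sup>1(J\<^sup>n\<^sup>-\<^sup>1(V))\<close> for a line bundle \<open>V\<close>.\<close>

definition is_jet_embedding :: "('a::t2_space, 'i) rsurface \<Rightarrow> nat \<Rightarrow> ('a, 'i) vbundle \<Rightarrow>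
    ('i \<Rightarrow> 'a \<Rightarrow> complex mat) \<Rightarrow> bool" where
  "is_jet_embedding X n V h \<longleftrightarrow>
     bundle_hom X (n + 1) (2 * n)
       (jet_bundle X n 1 V) (jet_bundle X 1 n (jet_bundle X (n - 1) 1 V)) h \<and>
     (\<forall>i\<in>Idx X. \<forall>S s. local_section X i 1 S s \<longrightarrow>
        (\<forall>x\<in>S. h i x *\<^sub>v jet X i n 1 s x = jet X i 1 n (jet X i (n - 1) 1 s) x))"

text \<open>
  A holomorphic connection on \<open>G\<close> is a first order operator from \<open>G\<close> to \<open>G \<otimes> K\<close> with symbol the
  identity.
\<close>

definition connection :: "('a::t2_space, 'i) rsurface \<Rightarrow> nat \<Rightarrow> ('a, 'i) vbundle \<Rightarrow>
    ('i \<Rightarrow> 'a \<Rightarrow> complex mat) \<Rightarrow> bool" where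
  "connection X m G D \<longleftrightarrow>
     bundle_hom X (2 * m) m (jet_bundle X 1 m G) (twist G (canon X) 1) D \<and>
     (\<forall>i\<in>Idx X. \<forall>x\<in>Dom X i. D i x * jet_incl 1 m = 1\<^sub>m m)"

text \<open>
  \<open>C\<close> is the connection on the top exterior power of a bundle of rank \<open>n\<close> induced by \<open>D\<close>:
  \<open>C (s\<^sub>1 \<and> \<dots> \<and> s\<^sub>n) = \<Sum>k. s\<^sub>1 \<and> \<dots> \<and> D s\<^sub>k \<and> \<dots> \<and> s\<^sub>n\<close>.
\<close>

definition wedge :: "nat \<Rightarrow> (nat \<Rightarrow> complex Matrix.vec) \<Rightarrow> complex" where
  "wedge n v = Determinant.det (Matrix.mat n n (\<lambda>(a, b). v b $ a))"

definition induced_det_connection :: "('a::t2_space, 'i) rsurface \<Rightarrow> nat \<Rightarrow>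
    ('i \<Rightarrow> 'a \<Rightarrow> complex mat) \<Rightarrow> ('i \<Rightarrow> 'a \<Rightarrow> complex mat) \<Rightarrow> bool" where
  "induced_det_connection X n D C \<longleftrightarrow>
     (\<forall>i\<in>Idx X. \<forall>x\<in>Dom X i. C i x \<in> carrier_mat 1 2) \<and>
     (\<forall>i\<in>Idx X. \<forall>S s. (\<forall>k<n. local_section X i n S (s k)) \<longrightarrow>
        (\<forall>x\<in>S. (C i x *\<^sub>v jet X i 1 1 (\<lambda>y. Matrix.vec 1 (\<lambda>_. wedge n (\<lambda>k. s k y))) x) $ 0 =
           (\<Sum>k<n. wedge n ((\<lambda>b. s b x)(k := D i x *\<^sub>v jet X i 1 n (s k) x)))))"

definition flat_section :: "('a::t2_space, 'i) rsurface \<Rightarrow> nat \<Rightarrow> ('a, 'i) vbundle \<Rightarrow>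
    ('i \<Rightarrow> 'a \<Rightarrow> complex mat) \<Rightarrow> 'a set \<Rightarrow> ('i \<Rightarrow> 'a \<Rightarrow> complex Matrix.vec) \<Rightarrow> bool" where
  "flat_section X m G D S s \<longleftrightarrow>
     open S \<and> holo_section X m G S s \<and>
     (\<forall>i\<in>Idx X. \<forall>x\<in>S \<inter> Dom X i. D i x *\<^sub>v jet X i 1 m (s i) x = 0\<^sub>v m)"

text \<open>
  A parallel vector field along \<open>\<gamma>\<close>; \<open>v t i\<close> are the coordinates in the \<open>i\<close>-th frame of a vector in
  the fibre over \<open>\<gamma> t\<close>, and are meaningful if \<open>\<gamma> t \<in> Dom X i\<close>.
\<close>

definition parallel_along :: "('a::t2_space, 'i) rsurface \<Rightarrow> nat \<Rightarrow> ('a, 'i) vbundle \<Rightarrow>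
    ('i \<Rightarrow> 'a \<Rightarrow> complex mat) \<Rightarrow> (real \<Rightarrow> 'a) \<Rightarrow> (real \<Rightarrow> 'i \<Rightarrow> complex Matrix.vec) \<Rightarrow> bool" where
  "parallel_along X m G D \<gamma> v \<longleftrightarrow>
     (\<forall>t\<in>{0..1}. \<exists>S s \<epsilon>. flat_section X m G D S s \<and> \<epsilon> > 0 \<and>
        (\<forall>t'\<in>{0..1}. \<bar>t' - t\<bar> < \<epsilon> \<longrightarrow> \<gamma> t' \<in> S \<and>
           (\<forall>i\<in>Idx X. \<gamma> t' \<in> Dom X i \<longrightarrow> v t' i = s i (\<gamma> t'))))"

definition trivial_monodromy :: "('a::t2_space, 'i) rsurface \<Rightarrow> nat \<Rightarrow> ('a, 'i) vbundle \<Rightarrow>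
    ('i \<Rightarrow> 'a \<Rightarrow> complex mat) \<Rightarrow> bool" where
  "trivial_monodromy X m G D \<longleftrightarrow>
     (\<forall>\<gamma> v. path \<gamma> \<and> pathfinish \<gamma> = pathstart \<gamma> \<and> parallel_along X m G D \<gamma> v \<longrightarrow>
        (\<forall>i\<in>Idx X. pathstart \<gamma> \<in> Dom X i \<longrightarrow> v 1 i = v 0 i))"

definition trivial_connection :: "('a::t2_space, 'i) rsurface \<Rightarrow> ('a, 'i) vbundle \<Rightarrow>
    ('i \<Rightarrow> 'a \<Rightarrow> complex mat) \<Rightarrow> bool" where
  "trivial_connection X G C \<longleftrightarrow> connection X 1 G C \<and> trivial_monodromy X 1 G C"

section \<open>Sections on the square of the surface and on neighbourhoods of the diagonal\<close>

text \<open>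
  \<open>\<kappa>\<close> is a section of \<open>\<O>(N\<Delta>)\<close> near the diagonal of \<open>S \<subseteq> Dom X i\<close>. Sections of \<open>\<O>(N\<Delta>)\<close> are identified
  with functions off the diagonal \<open>\<Delta>\<close> with a pole of order at most \<open>N\<close> along \<open>\<Delta>\<close>; a negative \<open>N\<close>
  prescribes a zero. Values on the diagonal are irrelevant.
\<close>

definition diag_order :: "('a::t2_space, 'i) rsurface \<Rightarrow> 'i \<Rightarrow> int \<Rightarrow> 'a set \<Rightarrow>
    ('a \<Rightarrow> 'a \<Rightarrow> complex) \<Rightarrow> bool" where
  "diag_order X i N S \<kappa> \<longleftrightarrow>
     (\<exists>W f. open W \<and> (\<forall>x\<in>S. (x, x) \<in> W) \<and> W \<subseteq> S \<times> S \<and> holo2_on X W f \<and>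
        (\<forall>x y. (x, y) \<in> W \<and> x \<noteq> y \<longrightarrow> (crd X i y - crd X i x) powi N * \<kappa> x y = f (x, y)))"

text \<open>
  The restriction to the diagonal of a section \<open>\<kappa>\<close> of \<open>\<O>(N\<Delta>)\<close>, as the coefficient of \<open>(d/dz\<^sub>i)\<^sup>N\<close>; the
  identification of the conormal bundle of the diagonal with \<open>K\<close> maps \<open>p\<^sub>2\<^sup>*h - p\<^sub>1\<^sup>*h\<close> to \<open>dh\<close>.
\<close>

definition diag_value :: "('a::t2_space, 'i) rsurface \<Rightarrow> 'i \<Rightarrow> int \<Rightarrow> ('a \<Rightarrow> 'a \<Rightarrow> complex) \<Rightarrow> 'a \<Rightarrow>
    complex \<Rightarrow> bool" where
  "diag_value X i N \<kappa> x c \<longleftrightarrow> ((\<lambda>y. (crd X i y - crd X i x) powi N * \<kappa> x y) \<longlongrightarrow> c) (at x)"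

text \<open>
  Sections over \<open>X \<times> X\<close> of \<open>p\<^sub>1\<^sup>*G \<otimes> p\<^sub>2\<^sup>*H\<^sup>* \<otimes> \<O>(N\<Delta>)\<close>, where \<open>G\<close>, \<open>H\<close> have ranks \<open>p\<close>, \<open>q\<close>. Over
  \<open>Dom X i \<times> Dom X j\<close> the section is a matrix-valued function, as an element of \<open>Hom(H\<^sub>y, G\<^sub>x)\<close>.
\<close>

definition kernel_section :: "('a::t2_space, 'i) rsurface \<Rightarrow> nat \<Rightarrow> nat \<Rightarrow>
    ('a, 'i) vbundle \<Rightarrow> ('a, 'i) vbundle \<Rightarrow> int \<Rightarrow> ('i \<Rightarrow> 'i \<Rightarrow> 'a \<Rightarrow> 'a \<Rightarrow> complex mat) \<Rightarrow> bool" where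
  "kernel_section X p q G H N \<kappa> \<longleftrightarrow>
     (\<forall>i\<in>Idx X. \<forall>j\<in>Idx X. \<forall>x\<in>Dom X i. \<forall>y\<in>Dom X j. \<kappa> i j x y \<in> carrier_mat p q) \<and>
     (\<forall>i\<in>Idx X. \<forall>j\<in>Idx X. \<forall>a<p. \<forall>b<q.
        holo2_on X {(x, y). x \<in> Dom X i \<and> y \<in> Dom X j \<and> x \<noteq> y} (\<lambda>(x, y). \<kappa> i j x y $$ (a, b))) \<and>
     (\<forall>i\<in>Idx X. \<forall>j\<in>Idx X. \<forall>i'\<in>Idx X. \<forall>j'\<in>Idx X.
        \<forall>x\<in>Dom X i \<inter> Dom X i'. \<forall>y\<in>Dom X j \<inter> Dom X j'. x \<noteq> y \<longrightarrow>
          \<kappa> i j x y = G i i' x * \<kappa> i' j' x y * H j' j y) \<and>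
     (\<forall>i\<in>Idx X. \<forall>a<p. \<forall>b<q. diag_order X i N (Dom X i) (\<lambda>x y. \<kappa> i i x y $$ (a, b)))"

text \<open>
  Sections of the same sheaf over \<open>k\<Delta>\<close>, i.e. of its quotient by the subsheaf with \<open>N - k\<close> in place of
  \<open>N\<close>. They are given by representatives \<open>\<kappa> i\<close> near the diagonal of \<open>Dom X i\<close>, which are only
  meaningful modulo this subsheaf.
\<close>

definition eq_mod_kDelta :: "('a::t2_space, 'i) rsurface \<Rightarrow> nat \<Rightarrow> nat \<Rightarrow> 'i \<Rightarrow> int \<Rightarrow> nat \<Rightarrow> 'a set \<Rightarrow>
    ('a \<Rightarrow> 'a \<Rightarrow> complex mat) \<Rightarrow> ('a \<Rightarrow> 'a \<Rightarrow> complex mat) \<Rightarrow> bool" where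
  "eq_mod_kDelta X p q i N k S \<kappa> \<kappa>' \<longleftrightarrow>
     (\<forall>a<p. \<forall>b<q. diag_order X i (N - int k) S (\<lambda>x y. \<kappa> x y $$ (a, b) - \<kappa>' x y $$ (a, b)))"

definition kernel_section_on_kDelta :: "('a::t2_space, 'i) rsurface \<Rightarrow> nat \<Rightarrow> nat \<Rightarrow>
    ('a, 'i) vbundle \<Rightarrow> ('a, 'i) vbundle \<Rightarrow> int \<Rightarrow> nat \<Rightarrow> ('i \<Rightarrow> 'a \<Rightarrow> 'a \<Rightarrow> complex mat) \<Rightarrow> bool" where
  "kernel_section_on_kDelta X p q G H N k \<kappa> \<longleftrightarrow>
     (\<forall>i\<in>Idx X. \<forall>x\<in>Dom X i. \<forall>y\<in>Dom X i. \<kappa> i x y \<in> carrier_mat p q) \<and>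
     (\<forall>i\<in>Idx X. \<forall>a<p. \<forall>b<q. diag_order X i N (Dom X i) (\<lambda>x y. \<kappa> i x y $$ (a, b))) \<and>
     (\<forall>i\<in>Idx X. \<forall>j\<in>Idx X. eq_mod_kDelta X p q i N k (Dom X i \<inter> Dom X j)
        (\<kappa> i) (\<lambda>x y. G i j x * \<kappa> j x y * H j i y))"

text \<open>
  \<open>residue_pairing X i \<kappa> f x\<close> is \<open>Res\<^bsub>y=x\<^esub> \<kappa>(x,y) f(y) dz\<^sub>i(y)\<close>, the residue being taken in the second
  variable.
\<close>

definition residue_pairing :: "('a, 'i) rsurface \<Rightarrow> 'i \<Rightarrow> ('a \<Rightarrow> 'a \<Rightarrow> complex) \<Rightarrow> ('a \<Rightarrow> complex) \<Rightarrow>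
    'a \<Rightarrow> complex" where
  "residue_pairing X i \<kappa> f x = residue (\<lambda>w. \<kappa> x (cinv X i w) * f (cinv X i w)) (crd X i x)"

text \<open>
  The section of \<open>p\<^sub>1\<^sup>*K \<otimes> p\<^sub>2\<^sup>*K \<otimes> \<O>(2\<Delta>)\<close> over \<open>2\<Delta>\<close> corresponding to the de Rham operator
  \<open>f \<mapsto> df\<close>.
\<close>

definition is_deRham_kernel :: "('a::t2_space, 'i) rsurface \<Rightarrow> ('i \<Rightarrow> 'a \<Rightarrow> 'a \<Rightarrow> complex) \<Rightarrow> bool" where
  "is_deRham_kernel X d1 \<longleftrightarrow>
     kernel_section_on_kDelta X 1 1 (lpow (canon X) 1) (lpow (canon X) (-1)) 2 2
       (\<lambda>i x y. scalar (d1 i x y)) \<and>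
     (\<forall>i\<in>Idx X. \<forall>S f. open S \<and> S \<subseteq> Dom X i \<and> holo_on X S f \<longrightarrow>
        (\<forall>x\<in>S. residue_pairing X i (d1 i) f x = tcoeff X i x 1 f))"

section \<open>The objects attached to a bundle in the moduli space\<close>

text \<open>
  In the following \<open>L\<close> is \<open>(L\<^sup>-\<^sup>1)\<^sup>*\<close>, so that \<open>p\<^sub>1\<^sup>*L \<otimes> p\<^sub>2\<^sup>*L \<otimes> \<O>(\<Delta>)\<close> is a case of the sheaves above. On
  \<open>\<Delta>\<close> it is trivialised by \<open>\<theta>\<close>, hence the factors \<open>\<theta> i x\<close>.
\<close>

definition is_A :: "('a::t2_space, 'i) rsurface \<Rightarrow> ('a, 'i) line_cocycle \<Rightarrow> ('i \<Rightarrow> 'a \<Rightarrow> complex) \<Rightarrow>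
    nat \<Rightarrow> ('a, 'i) vbundle \<Rightarrow> ('i \<Rightarrow> 'i \<Rightarrow> 'a \<Rightarrow> 'a \<Rightarrow> complex mat) \<Rightarrow> bool" where
  "is_A X l \<theta> r E A \<longleftrightarrow>
     kernel_section X r r (twist E l 1) (twist E l (-1)) 1 A \<and>
     (\<forall>i\<in>Idx X. \<forall>x\<in>Dom X i. \<forall>a<r. \<forall>b<r.
        diag_value X i 1 (\<lambda>x y. \<theta> i x * A i i x y $$ (a, b)) x (if a = b then 1 else 0))"

definition is_delta :: "('a::t2_space, 'i) rsurface \<Rightarrow> ('a, 'i) line_cocycle \<Rightarrow>
    ('i \<Rightarrow> 'a \<Rightarrow> complex) \<Rightarrow> ('i \<Rightarrow> 'a \<Rightarrow> 'a \<Rightarrow> complex) \<Rightarrow> bool" where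
  "is_delta X l \<theta> \<delta> \<longleftrightarrow>
     kernel_section_on_kDelta X 1 1 (lpow l 1) (lpow l (-1)) 1 2 (\<lambda>i x y. scalar (\<delta> i x y)) \<and>
     is_deRham_kernel X (\<lambda>i x y. \<theta> i x * \<theta> i y * (\<delta> i x y)\<^sup>2) \<and>
     (\<forall>i\<in>Idx X. \<forall>x\<in>Dom X i. diag_value X i 1 (\<lambda>x y. \<theta> i x * \<delta> i x y) x 1)"

definition is_Phi :: "('a::t2_space, 'i) rsurface \<Rightarrow> nat \<Rightarrow> ('a, 'i) vbundle \<Rightarrow>
    ('i \<Rightarrow> 'i \<Rightarrow> 'a \<Rightarrow> 'a \<Rightarrow> complex mat) \<Rightarrow> ('i \<Rightarrow> 'a \<Rightarrow> 'a \<Rightarrow> complex) \<Rightarrow>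
    ('i \<Rightarrow> 'a \<Rightarrow> 'a \<Rightarrow> complex mat) \<Rightarrow> bool" where
  "is_Phi X r E A \<delta> \<Phi> \<longleftrightarrow>
     kernel_section_on_kDelta X r r E E 0 2 \<Phi> \<and>
     (\<forall>i\<in>Idx X. eq_mod_kDelta X r r i 1 2 (Dom X i) (A i i) (\<lambda>x y. \<delta> i x y \<cdot>\<^sub>m \<Phi> i x y))"

text \<open>
  \<open>D\<^sup>E s\<close> is the difference of \<open>\<Phi>(x,y) s(y)\<close> and \<open>s(x)\<close> over \<open>2\<Delta>\<close>; this vanishes on \<open>\<Delta>\<close> and is thus
  a section of \<open>E \<otimes> K\<close>, namely the restriction to \<open>\<Delta>\<close> of a section of \<open>p\<^sub>1\<^sup>*E \<otimes> \<O>(-\<Delta>)\<close>.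
\<close>

definition is_DE :: "('a::t2_space, 'i) rsurface \<Rightarrow> nat \<Rightarrow> ('a, 'i) vbundle \<Rightarrow>
    ('i \<Rightarrow> 'a \<Rightarrow> 'a \<Rightarrow> complex mat) \<Rightarrow> ('i \<Rightarrow> 'a \<Rightarrow> complex mat) \<Rightarrow> bool" where
  "is_DE X r E \<Phi> DE \<longleftrightarrow>
     connection X r E DE \<and>
     (\<forall>i\<in>Idx X. \<forall>S s. local_section X i r S s \<longrightarrow> (\<forall>x\<in>S. \<forall>a<r.
        diag_value X i (-1) (\<lambda>x y. (\<Phi> i x y *\<^sub>v s y) $ a - s x $ a) x
          ((DE i x *\<^sub>v jet X i 1 r s x) $ a)))"

definition tubular_nbhd :: "('a::t2_space \<times> 'a) set \<Rightarrow> bool" where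
  "tubular_nbhd U \<longleftrightarrow> open U \<and> range (\<lambda>x. (x, x)) \<subseteq> U \<and>
     (\<exists>\<rho>. retraction U (range (\<lambda>x. (x, x))) \<rho> \<and>
        homotopic_with_canon (\<lambda>h. \<forall>p\<in>range (\<lambda>x. (x, x)). h p = p) U U id \<rho>)"

text \<open>
  The parallel isomorphism \<open>f : q\<^sub>1\<^sup>*E \<rightarrow> q\<^sub>2\<^sup>*E\<close>; \<open>f i j x y\<close> is its matrix from the \<open>i\<close>-th frame of \<open>E\<^sub>x\<close>
  to the \<open>j\<close>-th frame of \<open>E\<^sub>y\<close>. That \<open>f\<close> is parallel is stated for the two components of the
  connections: for a section \<open>s\<close> of \<open>q\<^sub>1\<^sup>*E\<close>, the pulled back connection \<open>q\<^sub>1\<^sup>*D\<close> is \<open>D\<close> in the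
  direction of \<open>x\<close>, and partial differentiation in the direction of \<open>y\<close>.
\<close>

definition vderiv :: "('a, 'i) rsurface \<Rightarrow> 'i \<Rightarrow> nat \<Rightarrow> ('a \<Rightarrow> complex Matrix.vec) \<Rightarrow> 'a \<Rightarrow>
    complex Matrix.vec" where
  "vderiv X i m s x = Matrix.vec m (\<lambda>a. tcoeff X i x 1 (\<lambda>y. s y $ a))"

definition is_parallel_iso :: "('a::t2_space, 'i) rsurface \<Rightarrow> nat \<Rightarrow> ('a, 'i) vbundle \<Rightarrow>
    ('i \<Rightarrow> 'a \<Rightarrow> complex mat) \<Rightarrow> ('a \<times> 'a) set \<Rightarrow>
    ('i \<Rightarrow> 'i \<Rightarrow> 'a \<Rightarrow> 'a \<Rightarrow> complex mat) \<Rightarrow> bool" where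
  "is_parallel_iso X r E D U f \<longleftrightarrow>
     (\<forall>i\<in>Idx X. \<forall>j\<in>Idx X. \<forall>(x, y)\<in>U \<inter> (Dom X i \<times> Dom X j).
        f i j x y \<in> carrier_mat r r \<and> invertible_mat (f i j x y)) \<and>
     (\<forall>i\<in>Idx X. \<forall>j\<in>Idx X. \<forall>a<r. \<forall>b<r.
        holo2_on X (U \<inter> (Dom X i \<times> Dom X j)) (\<lambda>(x, y). f i j x y $$ (a, b))) \<and>
     (\<forall>i\<in>Idx X. \<forall>j\<in>Idx X. \<forall>i'\<in>Idx X. \<forall>j'\<in>Idx X.
        \<forall>(x, y)\<in>U \<inter> ((Dom X i \<inter> Dom X i') \<times> (Dom X j \<inter> Dom X j')).
          f i j x y = E j j' y * f i' j' x y * E i' i x) \<and>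
     (\<forall>i\<in>Idx X. \<forall>x\<in>Dom X i. f i i x x = 1\<^sub>m r) \<and>
     (\<forall>i\<in>Idx X. \<forall>j\<in>Idx X. \<forall>W s.
        open W \<and> W \<subseteq> U \<inter> (Dom X i \<times> Dom X j) \<and> (\<forall>p\<in>W. s p \<in> carrier_vec r) \<and>
        (\<forall>a<r. holo2_on X W (\<lambda>p. s p $ a)) \<longrightarrow>
        (\<forall>(x, y)\<in>W.
           f i j x y *\<^sub>v (D i x *\<^sub>v jet X i 1 r (\<lambda>x'. s (x', y)) x) =
             vderiv X i r (\<lambda>x'. f i j x' y *\<^sub>v s (x', y)) x \<and>
           f i j x y *\<^sub>v vderiv X j r (\<lambda>y'. s (x, y')) y =
             D j y *\<^sub>v jet X j 1 r (\<lambda>y'. f i j x y' *\<^sub>v s (x, y')) y))"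

definition beta_hat :: "nat \<Rightarrow> ('i \<Rightarrow> 'i \<Rightarrow> 'a \<Rightarrow> 'a \<Rightarrow> complex mat) \<Rightarrow>
    ('i \<Rightarrow> 'i \<Rightarrow> 'a \<Rightarrow> 'a \<Rightarrow> complex mat) \<Rightarrow> 'i \<Rightarrow> 'i \<Rightarrow> 'a \<Rightarrow> 'a \<Rightarrow> complex" where
  "beta_hat r A f i j x y = 1 / of_nat r * (\<Sum>a<r. (A i j x y * f i j x y) $$ (a, a))"

text \<open>
  The operator from \<open>L\<^bsup>1-n\<^esup>\<close> to \<open>L\<^bsup>n+1\<^esup>\<close> given by the restriction to \<open>(n+1)\<Delta>\<close> of the \<open>(n+1)\<close>-st power of
  \<open>\<beta>\<close>. The pairing of \<open>L\<^bsup>n+1\<^esup>\<close> with \<open>L\<^bsup>1-n\<^esup>\<close> takes values in the square of \<open>L\<close>, hence the factor \<open>\<theta> i y\<close>.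
\<close>

definition is_beta_operator :: "('a::t2_space, 'i) rsurface \<Rightarrow> ('a, 'i) line_cocycle \<Rightarrow>
    ('i \<Rightarrow> 'a \<Rightarrow> complex) \<Rightarrow> nat \<Rightarrow> ('i \<Rightarrow> 'i \<Rightarrow> 'a \<Rightarrow> 'a \<Rightarrow> complex) \<Rightarrow>
    ('i \<Rightarrow> 'a \<Rightarrow> complex mat) \<Rightarrow> bool" where
  "is_beta_operator X l \<theta> n \<beta> \<rho> \<longleftrightarrow>
     bundle_hom X (n + 1) 1 (jet_bundle X n 1 (lpow l (1 - int n))) (lpow l (int n + 1)) \<rho> \<and>
     (\<forall>i\<in>Idx X. \<forall>S s. local_section X i 1 S s \<longrightarrow> (\<forall>x\<in>S.
        (\<rho> i x *\<^sub>v jet X i n 1 s x) $ 0 =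
          residue_pairing X i (\<lambda>x y. (\<beta> i i x y) ^ (n + 1) * \<theta> i y) (\<lambda>y. s y $ 0) x))"

text \<open>The splitting \<open>\<D>\<^sub>1\<close> of \<open>J\<^sup>n(V) \<rightarrow> J\<^sup>n\<^sup>-\<^sup>1(V)\<close> whose image is the kernel of \<open>\<rho>\<close>.\<close>

definition is_D1 :: "('a::t2_space, 'i) rsurface \<Rightarrow> nat \<Rightarrow> ('a, 'i) vbundle \<Rightarrow>
    ('i \<Rightarrow> 'a \<Rightarrow> complex mat) \<Rightarrow> ('i \<Rightarrow> 'a \<Rightarrow> complex mat) \<Rightarrow> bool" where
  "is_D1 X n V \<rho> D1 \<longleftrightarrow>
     bundle_hom X n (n + 1) (jet_bundle X (n - 1) 1 V) (jet_bundle X n 1 V) D1 \<and>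
     (\<forall>i\<in>Idx X. \<forall>x\<in>Dom X i.
        \<rho> i x * D1 i x = 0\<^sub>m 1 n \<and> jet_trunc n 1 * D1 i x = 1\<^sub>m n)"

definition is_DD :: "('a::t2_space, 'i) rsurface \<Rightarrow> nat \<Rightarrow> ('a, 'i) vbundle \<Rightarrow>
    ('i \<Rightarrow> 'a \<Rightarrow> complex mat) \<Rightarrow> ('i \<Rightarrow> 'a \<Rightarrow> complex mat) \<Rightarrow> bool" where
  "is_DD X n V D2 D \<longleftrightarrow>
     bundle_hom X (2 * n) n (jet_bundle X 1 n (jet_bundle X (n - 1) 1 V))
       (twist (jet_bundle X (n - 1) 1 V) (canon X) 1) D \<and>
     (\<forall>i\<in>Idx X. \<forall>x\<in>Dom X i. D i x * D2 i x = 0\<^sub>m n n \<and> D i x * jet_incl 1 n = 1\<^sub>m n)"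

end

theory Submission
  imports Defs
begin

text \<open>
  The induced connection can be computed in the charts. There, write \<open>\<theta>\<close> for the function by which
  the square of the frame of \<open>L\<close> differs from \<open>dz\<close>, and let \<open>N = n (n - 1) / 2\<close>. The bundle
  \<open>J\<^sup>n\<^sup>-\<^sup>1(L\<^bsup>1-n\<^esup>)\<close> is filtered with quotients \<open>L\<^bsup>1-n\<^esup> \<otimes> K\<^sup>q\<close>, \<open>q < n\<close>, so its determinant is a power of
  \<open>K \<otimes> L\<^sup>-\<^sup>2\<close>, and the local functions \<open>\<theta>\<^sup>N\<close> form a nowhere vanishing global section of it
  (\<open>det_jet_bundle_theta_char\<close>). It suffices that the induced connection makes this section flat: a
  parallel field along a loop is then a constant multiple of it, and so returns to its initial value
  (\<open>trivial_connection_if_flat_frame\<close>).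

  Let \<open>\<rho>\<^sub>k\<close> be the coefficients of the operator given by \<open>\<beta>\<^bsup>n+1\<^esup>\<close> on the jets \<open>(w - z)\<^sup>k\<close>. The
  connection \<open>\<D>(E)\<close> is, in the coordinates of the jets, the companion system of this operator. The
  induced connection on the determinant has the trace of its matrix, which is
  \<open>n \<rho>\<^sub>n\<^sub>-\<^sub>1 / \<rho>\<^sub>n\<close> (\<open>companion_trace\<close>, \<open>induced_det_connection_index\<close>). Thus only the two leading
  coefficients matter, and as these are residues of \<open>\<beta>(z,w)\<^bsup>n+1\<^esup> \<theta>(w) (w - z)\<^sup>k\<close> for \<open>k = n\<close> and
  \<open>k = n - 1\<close>, they depend only on \<open>\<beta>\<close> over \<open>2\<Delta>\<close> (\<open>beta_operator_index\<close>).

  Over \<open>2\<Delta>\<close>, \<open>\<beta>\<close> does not depend on \<open>E\<close>: it equals \<open>\<delta>\<close>. Indeed \<open>A = \<delta> \<Phi>\<close> there, \<open>\<Phi>\<close> is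
  \<open>1 + \<Gamma> (w - z)\<close> where \<open>\<Gamma>\<close> is the matrix of the connection \<open>D\<^sup>E\<close>, and the parallel isomorphism \<open>f\<close>
  is \<open>1 - \<Gamma> (w - z)\<close>, so that \<open>\<Gamma>\<close> cancels in the product (\<open>beta_hat_expansion\<close>). Finally \<open>\<delta>\<close> is a
  square root of the kernel of the de Rham operator, which has no residue term, and this gives
  \<open>\<delta>(z,w) = (1 / (w - z) - \<theta>'(z) / (2 \<theta>(z))) / \<theta>(z)\<close> over \<open>2\<Delta>\<close> (\<open>delta_expansion\<close>). Inserting
  this, \<open>n \<rho>\<^sub>n\<^sub>-\<^sub>1 / \<rho>\<^sub>n = - N \<theta>' / \<theta>\<close>, which says that \<open>\<theta>\<^sup>N\<close> is flat.
\<close>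

section \<open>Taylor series in the charts of a Riemann surface\<close>

definition holo_at :: "('a, 'i) rsurface \<Rightarrow> 'i \<Rightarrow> 'a \<Rightarrow> ('a \<Rightarrow> complex) \<Rightarrow> bool" where
  "holo_at X i x f \<longleftrightarrow> (f \<circ> cinv X i) analytic_on {crd X i x}"

definition taylor :: "('a, 'i) rsurface \<Rightarrow> 'i \<Rightarrow> 'a \<Rightarrow> ('a \<Rightarrow> complex) \<Rightarrow> complex fps" where
  "taylor X i x f = fps_expansion (f \<circ> cinv X i) (crd X i x)"

lemma tcoeff_eq_taylor: "tcoeff X i x k f = fps_nth (taylor X i x f) k"
  by (simp add: tcoeff_def taylor_def fps_expansion_def)

lemma taylor_eqI:
  assumes "(\<lambda>h. f (cinv X i (crd X i x + h))) has_fps_expansion F"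
  shows "taylor X i x f = F" and "holo_at X i x f"
proof -
  show h: "holo_at X i x f"
    unfolding holo_at_def using assms
    by (intro has_fps_expansion_imp_analytic[where F = F]) (simp add: o_def)
  show "taylor X i x f = F"
    using analytic_at_imp_has_fps_expansion[OF h[unfolded holo_at_def]] assms
    unfolding taylor_def by (auto intro: fps_expansion_unique_complex simp: o_def)
qed

lemma taylor_expansion:
  assumes "holo_at X i x f"
  shows "(\<lambda>h. f (cinv X i (crd X i x + h))) has_fps_expansion taylor X i x f"
  using analytic_at_imp_has_fps_expansion[OF assms[unfolded holo_at_def]]
  by (simp add: taylor_def o_def)

lemma taylor_const: "taylor X i x (\<lambda>_. c) = fps_const c" "holo_at X i x (\<lambda>_. c)"
  by (rule taylor_eqI) (simp_all add: holo_at_def o_def)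

lemma taylor_add:
  assumes "holo_at X i x f" "holo_at X i x g"
  shows "taylor X i x (\<lambda>y. f y + g y) = taylor X i x f + taylor X i x g"
    and "holo_at X i x (\<lambda>y. f y + g y)"
proof -
  show "holo_at X i x (\<lambda>y. f y + g y)"
    using assms unfolding holo_at_def o_def by (intro analytic_intros) auto
qed (rule taylor_eqI, intro fps_expansion_intros taylor_expansion assms)

lemma taylor_mult:
  assumes "holo_at X i x f" "holo_at X i x g"
  shows "taylor X i x (\<lambda>y. f y * g y) = taylor X i x f * taylor X i x g"
    and "holo_at X i x (\<lambda>y. f y * g y)"
proof -
  show "holo_at X i x (\<lambda>y. f y * g y)"
    using assms unfolding holo_at_def o_def by (intro analytic_intros) auto
qed (rule taylor_eqI, intro fps_expansion_intros taylor_expansion assms)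

lemma taylor_power:
  assumes "holo_at X i x f"
  shows "taylor X i x (\<lambda>y. f y ^ k) = taylor X i x f ^ k" and "holo_at X i x (\<lambda>y. f y ^ k)"
proof -
  show "holo_at X i x (\<lambda>y. f y ^ k)"
    using assms unfolding holo_at_def o_def by (intro analytic_intros) auto
qed (rule taylor_eqI, intro fps_expansion_intros taylor_expansion assms)

lemma taylor_sum:
  assumes "\<And>a. a \<in> A \<Longrightarrow> holo_at X i x (f a)"
  shows "taylor X i x (\<lambda>y. \<Sum>a\<in>A. f a y) = (\<Sum>a\<in>A. taylor X i x (f a))"
    and "holo_at X i x (\<lambda>y. \<Sum>a\<in>A. f a y)"
proof -
  show "holo_at X i x (\<lambda>y. \<Sum>a\<in>A. f a y)"
    using assms unfolding holo_at_def o_def by (intro analytic_intros) auto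
qed (rule taylor_eqI, intro fps_expansion_intros taylor_expansion assms)

locale riemann_charts =
  fixes X :: "('a::t2_space, 'i) rsurface"
  assumes surface: "riemann_surface X"
begin

lemma chart:
  assumes "i \<in> Idx X"
  shows "open (Dom X i)" "open (crd X i ` Dom X i)"
    "homeomorphism (Dom X i) (crd X i ` Dom X i) (crd X i) (cinv X i)"
  using surface assms by (auto simp: riemann_surface_def)

lemma chart_cover: "\<exists>i\<in>Idx X. x \<in> Dom X i"
  using surface by (auto simp: riemann_surface_def)

lemma cinv_crd: "i \<in> Idx X \<Longrightarrow> x \<in> Dom X i \<Longrightarrow> cinv X i (crd X i x) = x"
  using chart(3) by (auto simp: homeomorphism_def)

lemma crd_cinv: "i \<in> Idx X \<Longrightarrow> z \<in> crd X i ` Dom X i \<Longrightarrow> crd X i (cinv X i z) = z"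
  using chart(3)[of i] by (auto simp: homeomorphism_def)

lemma crd_eq_iff:
  "i \<in> Idx X \<Longrightarrow> x \<in> Dom X i \<Longrightarrow> y \<in> Dom X i \<Longrightarrow> crd X i x = crd X i y \<longleftrightarrow> x = y"
  by (metis cinv_crd)

lemma open_crd_image:
  assumes "i \<in> Idx X" "open S" "S \<subseteq> Dom X i"
  shows "open (crd X i ` S)"
  using assms homeomorphism_imp_open_map[OF chart(3), of i S] chart(1,2)[of i]
  by (metis inf.absorb_iff2 openin_open_eq openin_open_trans openin_subtopology_Int2 open_openin)

lemma eventually_crd_image:
  assumes "i \<in> Idx X" "x \<in> Dom X i"
  shows "\<forall>\<^sub>F w in nhds (crd X i x). w \<in> crd X i ` Dom X i"
  using chart(2)[OF assms(1)] assms(2) by (intro eventually_nhds_in_open) auto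

lemma tendsto_cinv:
  assumes "i \<in> Idx X" "x \<in> Dom X i"
  shows "filterlim (cinv X i) (nhds x) (nhds (crd X i x))"
proof -
  have "continuous_on (crd X i ` Dom X i) (cinv X i)"
    using chart(3)[OF assms(1)] by (simp add: homeomorphism_def)
  then have "isCont (cinv X i) (crd X i x)"
    using chart(2)[OF assms(1)] assms(2) continuous_on_eq_continuous_at by blast
  then show ?thesis
    using cinv_crd[OF assms] by (simp add: isCont_def tendsto_nhds_iff)
qed

lemma tendsto_cinv_punctured:
  assumes "i \<in> Idx X" "x \<in> Dom X i"
  shows "filterlim (cinv X i) (at x) (at (crd X i x))"
proof -
  have "\<forall>\<^sub>F w in at (crd X i x). cinv X i w \<noteq> x"
    using eventually_at_filter eventually_mono[OF eventually_crd_image[OF assms]] assms crd_cinv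
    by (smt (verit, best) eventually_at_filter eventually_mono)
  moreover have "filterlim (cinv X i) (nhds x) (at (crd X i x))"
    using tendsto_cinv[OF assms] by (rule filterlim_mono) (auto simp: at_le at_within_le_nhds)
  ultimately show ?thesis by (simp add: filterlim_at)
qed

lemma eventually_cinv:
  assumes "i \<in> Idx X" "x \<in> Dom X i"
  shows "\<forall>\<^sub>F y in nhds x. P y \<Longrightarrow> \<forall>\<^sub>F w in nhds (crd X i x). P (cinv X i w)"
    and "\<forall>\<^sub>F y in at x. P y \<Longrightarrow> \<forall>\<^sub>F w in at (crd X i x). P (cinv X i w)"
  using tendsto_cinv[OF assms] tendsto_cinv_punctured[OF assms] by (auto simp: filterlim_iff)

lemma taylor_cong:
  assumes "i \<in> Idx X" "x \<in> Dom X i" "\<forall>\<^sub>F y in nhds x. f y = g y"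
  shows "taylor X i x f = taylor X i x g"
  using eventually_cinv(1)[OF assms] unfolding taylor_def
  by (intro fps_expansion_cong) (simp add: o_def)

lemma holo_at_cong:
  assumes "i \<in> Idx X" "x \<in> Dom X i" "\<forall>\<^sub>F y in nhds x. f y = g y" "holo_at X i x f"
  shows "holo_at X i x g"
  using eventually_cinv(1)[OF assms(1-3)] assms(4) analytic_at_cong
  unfolding holo_at_def by (force simp: o_def)

lemma taylor_nth_0:
  assumes "i \<in> Idx X" "x \<in> Dom X i"
  shows "fps_nth (taylor X i x f) 0 = f x"
  using assms by (simp add: taylor_def fps_expansion_def cinv_crd)

lemma taylor_crd:
  assumes "i \<in> Idx X" "x \<in> Dom X i"
  shows "taylor X i x (\<lambda>y. crd X i y - crd X i x) = fps_X"
    and "holo_at X i x (\<lambda>y. crd X i y - crd X i x)"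
proof -
  have "\<forall>\<^sub>F w in nhds (crd X i x). crd X i (cinv X i w) - crd X i x = w - crd X i x"
    by (rule eventually_mono[OF eventually_crd_image[OF assms]]) (use assms crd_cinv in auto)
  then have ev: "\<forall>\<^sub>F h in nhds 0. h = crd X i (cinv X i (crd X i x + h)) - crd X i x"
    unfolding nhds_to_0[of "crd X i x"] eventually_filtermap
    by (rule eventually_mono) (simp add: add.commute)
  note expansion = iffD1[OF has_fps_expansion_cong[OF ev refl] has_fps_expansion_fps_X]
  show "taylor X i x (\<lambda>y. crd X i y - crd X i x) = fps_X"
    by (rule taylor_eqI(1)[OF expansion])
  show "holo_at X i x (\<lambda>y. crd X i y - crd X i x)"
    by (rule taylor_eqI(2)[OF expansion])
qed

lemma holo_on_imp_holo_at:
  assumes "i \<in> Idx X" "x \<in> S" "x \<in> Dom X i" "open S" "holo_on X S f"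
  shows "holo_at X i x f"
  unfolding holo_at_def
proof (rule holomorphic_on_imp_analytic_at)
  show "(f \<circ> cinv X i) holomorphic_on crd X i ` (S \<inter> Dom X i)"
    using assms by (auto simp: holo_on_def)
  show "open (crd X i ` (S \<inter> Dom X i))"
    using assms chart(1) by (intro open_crd_image) auto
qed (use assms in auto)

lemma holo_on_const: "holo_on X S (\<lambda>_. c)"
  by (simp add: holo_on_def o_def)

lemma holo_on_crd:
  assumes "i \<in> Idx X"
  shows "holo_on X (Dom X i) (crd X i)"
  using surface assms by (auto simp: holo_on_def riemann_surface_def Int_commute)

lemma holo_on_crd_power:
  assumes "i \<in> Idx X"
  shows "holo_on X (Dom X i) (\<lambda>y. (crd X i y - c) ^ k)"
  using holo_on_crd[OF assms] unfolding holo_on_def o_def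
  by (auto intro!: holomorphic_intros)

text \<open>
  The chain rule. The second part is what makes holomorphy at a point independent of the chart, so
  that it need only be verified in the chart in which a local formula is given.
\<close>

lemma taylor_change_of_chart:
  assumes ij: "i \<in> Idx X" "j \<in> Idx X" and x: "x \<in> Dom X i" "x \<in> Dom X j"
    and f: "holo_at X j x f"
  shows "fps_nth (taylor X i x f) 1 = fps_nth (taylor X j x f) 1 * canon X i j x"
    and "holo_at X i x f"
proof -
  define g where "g = crd X j \<circ> cinv X i"
  have g: "g analytic_on {crd X i x}"
    using holo_on_imp_holo_at[OF ij(1) x(2,1) chart(1)[OF ij(2)] holo_on_crd[OF ij(2)]]
    by (simp add: holo_at_def g_def)
  have gx: "g (crd X i x) = crd X j x" using ij x by (simp add: g_def cinv_crd)
  have "\<forall>\<^sub>F y in nhds x. y \<in> Dom X j"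
    using chart(1)[OF ij(2)] x by (intro eventually_nhds_in_open)
  then have "\<forall>\<^sub>F w in nhds (crd X i x). cinv X i w \<in> Dom X j"
    by (rule eventually_cinv(1)[OF ij(1) x(1)])
  then have ev: "\<forall>\<^sub>F w in nhds (crd X i x). (f \<circ> cinv X i) w = ((f \<circ> cinv X j) \<circ> g) w"
    by (rule eventually_mono) (use ij cinv_crd in \<open>auto simp: g_def\<close>)
  have f': "(f \<circ> cinv X j) analytic_on {g (crd X i x)}"
    using f by (simp add: holo_at_def gx)
  have "((f \<circ> cinv X j) \<circ> g) analytic_on {crd X i x}"
    using g f' by (intro analytic_on_compose) auto
  then show "holo_at X i x f"
    unfolding holo_at_def using analytic_at_cong[OF ev refl] by blast
  have "deriv (f \<circ> cinv X i) (crd X i x) = deriv ((f \<circ> cinv X j) \<circ> g) (crd X i x)"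
    by (rule deriv_cong_ev[OF ev refl])
  also have "\<dots> = deriv (f \<circ> cinv X j) (crd X j x) * deriv g (crd X i x)"
    using deriv_chain[of g "crd X i x" "f \<circ> cinv X j"] g f' gx
    by (auto dest: analytic_on_imp_differentiable_at)
  finally show "fps_nth (taylor X i x f) 1 = fps_nth (taylor X j x f) 1 * canon X i j x"
    by (simp add: taylor_def fps_expansion_def canon_def tcoeff_def g_def)
qed

text \<open>
  The derivative of the coordinate \<open>c\<^sub>p\<close> of the jets of a section is \<open>(p + 1) c\<^sub>p\<^sub>+\<^sub>1\<close>. This gives the matrix
  of the embedding of \<open>J\<^sup>n\<close> into \<open>J\<^sup>1(J\<^sup>n\<^sup>-\<^sup>1)\<close>, and is the source of the factor \<open>n\<close> in the trace of the
  connection.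
\<close>

lemma tcoeff_tcoeff:
  assumes ix: "i \<in> Idx X" "x \<in> Dom X i" and f: "holo_at X i x f"
  shows "tcoeff X i x 1 (\<lambda>y. tcoeff X i y p f) = of_nat (Suc p) * tcoeff X i x (Suc p) f"
    and "holo_at X i x (\<lambda>y. tcoeff X i y p f)"
proof -
  define F where "F = f \<circ> cinv X i"
  have "(deriv ^^ p) F analytic_on {crd X i x}"
    using f by (auto simp: holo_at_def F_def intro: analytic_higher_deriv)
  note an = this
  then have d: "(deriv ^^ p) F field_differentiable at (crd X i x)"
    by (auto dest: analytic_on_imp_differentiable_at)
  have ev: "\<forall>\<^sub>F w in nhds (crd X i x).
      ((\<lambda>y. tcoeff X i y p f) \<circ> cinv X i) w = (deriv ^^ p) F w / fact p"
    by (rule eventually_mono[OF eventually_crd_image[OF ix]])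
      (use crd_cinv[OF ix(1)] in \<open>auto simp: tcoeff_def F_def\<close>)
  have "(\<lambda>w. (deriv ^^ p) F w / fact p) analytic_on {crd X i x}"
    by (rule analytic_on_divide[OF an analytic_on_const]) simp
  then show "holo_at X i x (\<lambda>y. tcoeff X i y p f)"
    using analytic_at_cong[OF ev refl] by (simp add: holo_at_def o_def)
  from deriv_cong_ev[OF ev refl]
  have "tcoeff X i x 1 (\<lambda>y. tcoeff X i y p f) = deriv (\<lambda>w. (deriv ^^ p) F w / fact p) (crd X i x)"
    unfolding tcoeff_def[of X i x 1] by (simp add: o_def)
  also have "\<dots> = deriv ((deriv ^^ p) F) (crd X i x) / fact p"
    using d by (rule deriv_cdivide_right)
  also have "\<dots> = of_nat (Suc p) * tcoeff X i x (Suc p) f"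
    by (simp add: tcoeff_def F_def field_simps del: of_nat_Suc)
  finally show "tcoeff X i x 1 (\<lambda>y. tcoeff X i y p f) = of_nat (Suc p) * tcoeff X i x (Suc p) f" .
qed

lemma holo_on_if_holo_at:
  assumes i: "i \<in> Idx X" and S: "S \<subseteq> Dom X i" and f: "\<And>x. x \<in> S \<Longrightarrow> holo_at X i x f"
  shows "holo_on X S f"
  unfolding holo_on_def
proof
  fix j assume j: "j \<in> Idx X"
  have "holo_at X j x f" if "x \<in> S" "x \<in> Dom X j" for x
    using taylor_change_of_chart(2)[OF j i that(2) _ f] that S by auto
  then have "(f \<circ> cinv X j) analytic_on crd X j ` (S \<inter> Dom X j)"
    unfolding holo_at_def by (subst analytic_on_analytic_at) auto
  then show "(f \<circ> cinv X j) holomorphic_on crd X j ` (S \<inter> Dom X j)"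
    by (rule analytic_imp_holomorphic)
qed

lemma holo2_slice:
  assumes ij: "i \<in> Idx X" "j \<in> Idx X" and xy: "x \<in> Dom X i" "y \<in> Dom X j" "(x, y) \<in> W"
    and W: "open W" and F: "holo2_on X W F"
  shows "holo_at X j y (\<lambda>y'. F (x, y'))"
proof -
  define T where "T = {y'. (x, y') \<in> W} \<inter> Dom X j"
  have "open {y'. (x, y') \<in> W}"
    using open_vimage[OF W, of "Pair x"] by (simp add: vimage_def continuous_intros)
  then have T: "open T" "T \<subseteq> Dom X j" "y \<in> T"
    using chart(1)[OF ij(2)] xy by (auto simp: T_def)
  have "(\<lambda>w. F (x, cinv X j w)) field_differentiable at w" if w: "w \<in> crd X j ` T" for w
  proof -
    obtain y' where y': "y' \<in> T" "w = crd X j y'" using w by auto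
    obtain a b where "((\<lambda>(z, w). F (cinv X i z, cinv X j w)) has_derivative (\<lambda>(h, k). a * h + b * k))
                 (at (crd X i x, crd X j y'))"
      using F ij xy y' unfolding holo2_on_def T_def by blast
    then have *: "((\<lambda>(z, w). F (cinv X i z, cinv X j w)) has_derivative (\<lambda>(h, k). a * h + b * k))
                 (at (crd X i x, w))"
      by (simp add: y')
    have "((\<lambda>w. (crd X i x, w)) has_derivative (\<lambda>k. (0, k))) (at w)"
      by (auto intro!: derivative_eq_intros)
    from has_derivative_compose[where f = "\<lambda>w. (crd X i x, w)", OF this *]
    have "((\<lambda>w. F (cinv X i (crd X i x), cinv X j w)) has_derivative (\<lambda>k. b * k)) (at w)"
      by simp
    then show ?thesis
      using cinv_crd[OF ij(1) xy(1)]
      by (auto simp: field_differentiable_def has_field_derivative_def)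
  qed
  then have "(\<lambda>w. F (x, cinv X j w)) holomorphic_on crd X j ` T"
    by (simp add: holomorphic_on_def field_differentiable_at_within)
  moreover have "open (crd X j ` T)"
    using open_crd_image[OF ij(2)] T by blast
  ultimately show ?thesis
    unfolding holo_at_def o_def using T by (intro holomorphic_on_imp_analytic_at) auto
qed

text \<open>
  Kernels may take arbitrary values on the diagonal. For a fixed first argument they are therefore
  compared with functions that are holomorphic across the diagonal, in punctured neighbourhoods.
\<close>

lemma diag_order_slice:
  assumes "i \<in> Idx X" "x \<in> Dom X i" "diag_order X i N (Dom X i) \<kappa>"
  obtains h where "holo_at X i x h"
    "\<forall>\<^sub>F y in at x. (crd X i y - crd X i x) powi N * \<kappa> x y = h y"
proof -
  obtain W F where W: "open W" "\<forall>x\<in>Dom X i. (x, x) \<in> W" "holo2_on X W F"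
    "\<And>x y. (x, y) \<in> W \<Longrightarrow> x \<noteq> y \<Longrightarrow> (crd X i y - crd X i x) powi N * \<kappa> x y = F (x, y)"
    using assms(3) unfolding diag_order_def by blast
  have "open {y. (x, y) \<in> W}"
    using open_vimage[OF W(1), of "Pair x"] by (simp add: vimage_def continuous_intros)
  then have "\<forall>\<^sub>F y in nhds x. (x, y) \<in> W"
    using eventually_nhds_in_open[of "{y. (x, y) \<in> W}" x] W(2) assms(2) by simp
  then have "\<forall>\<^sub>F y in at x. (crd X i y - crd X i x) powi N * \<kappa> x y = F (x, y)"
    unfolding eventually_at_filter by (rule eventually_mono) (use W(4) in auto)
  with holo2_slice[OF assms(1,1,2,2) _ W(1,3)] W(2) assms(2) show ?thesis
    using that by blast
qed

lemma holo_at_tendsto: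
  assumes "i \<in> Idx X" "x \<in> Dom X i" "holo_at X i x h"
  shows "((h \<circ> cinv X i) \<longlongrightarrow> h x) (at (crd X i x))"
  using analytic_at_imp_isCont[of "h \<circ> cinv X i" "crd X i x"] assms
  by (auto simp: holo_at_def isCont_def cinv_crd)

lemma diag_value_unique:
  assumes ix: "i \<in> Idx X" "x \<in> Dom X i" and v: "diag_value X i N \<kappa> x c"
    and h: "holo_at X i x h" "\<forall>\<^sub>F y in at x. (crd X i y - crd X i x) powi N * \<kappa> x y = h y"
  shows "h x = c"
proof -
  have "(h \<longlongrightarrow> c) (at x)"
    using v h(2) unfolding diag_value_def by (rule Lim_transform_eventually)
  from filterlim_compose[OF this tendsto_cinv_punctured[OF ix]]
  have "((h \<circ> cinv X i) \<longlongrightarrow> c) (at (crd X i x))" by (simp add: o_def)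
  from tendsto_unique[OF _ holo_at_tendsto[OF ix h(1)] this] show ?thesis by simp
qed

lemma taylor_eq_if_eq_punctured:
  assumes ix: "i \<in> Idx X" "x \<in> Dom X i" and "holo_at X i x f" "holo_at X i x g"
    and ev: "\<forall>\<^sub>F y in at x. f y = g y"
  shows "taylor X i x f = taylor X i x g"
proof -
  have "((f \<circ> cinv X i) \<longlongrightarrow> g x) (at (crd X i x))"
    using eventually_cinv(2)[OF ix ev] holo_at_tendsto[OF ix assms(4)]
    by (smt (verit, best) comp_apply eventually_mono tendsto_cong)
  then have "f x = g x"
    using tendsto_unique[OF _ holo_at_tendsto[OF ix assms(3)]] by simp
  with ev have "\<forall>\<^sub>F y in nhds x. f y = g y"
    unfolding eventually_at_filter by (auto elim: eventually_mono)
  then show ?thesis by (rule taylor_cong[OF ix])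
qed

text \<open>A pole of known order is removed by a power of the coordinate; its residue is then a Taylor coefficient.\<close>

lemma residue_pairing_taylor:
  assumes ix: "i \<in> Idx X" "x \<in> Dom X i" and h: "holo_at X i x h"
    and ev: "\<forall>\<^sub>F y in at x. (crd X i y - crd X i x) ^ Suc k * (\<kappa> x y * f y) = h y"
  shows "residue_pairing X i \<kappa> f x = fps_nth (taylor X i x h) k"
proof -
  have "\<forall>\<^sub>F w in at (crd X i x). w \<in> crd X i ` Dom X i"
    using eventually_crd_image[OF ix] by (simp add: eventually_at_filter eventually_mono)
  moreover have "\<forall>\<^sub>F w in at (crd X i x). w \<noteq> crd X i x"
    by (simp add: eventually_at_filter)
  ultimately have "\<forall>\<^sub>F w in at (crd X i x).
      \<kappa> x (cinv X i w) * f (cinv X i w) = (h \<circ> cinv X i) w / (w - crd X i x) ^ Suc k"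
    using eventually_cinv(2)[OF ix ev]
  proof eventually_elim
    case (elim w)
    then show ?case
      using crd_cinv[OF ix(1) elim(1)] by (simp add: nonzero_eq_divide_eq mult.commute)
  qed
  from residue_cong[OF this refl]
  have "residue_pairing X i \<kappa> f x
      = residue (\<lambda>w. (h \<circ> cinv X i) w / (w - crd X i x) ^ Suc k) (crd X i x)"
    by (simp add: residue_pairing_def)
  also obtain A where "open A" "crd X i x \<in> A" "(h \<circ> cinv X i) holomorphic_on A"
    using h by (auto simp: holo_at_def analytic_at)
  from residue_holomorphic_over_power[OF this]
  have "residue (\<lambda>w. (h \<circ> cinv X i) w / (w - crd X i x) ^ Suc k) (crd X i x)
      = fps_nth (taylor X i x h) k"
    by (simp add: taylor_def fps_expansion_def)
  finally show ?thesis .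
qed

end

section \<open>The companion form of a jet connection\<close>

lemma index_mult_mat_sum:
  assumes "M \<in> carrier_mat p q" "N \<in> carrier_mat q r" "a < p" "b < r"
  shows "(M * N) $$ (a, b) = (\<Sum>c<q. M $$ (a, c) * N $$ (c, b))"
  using assms by (auto simp: scalar_prod_def atLeast0LessThan intro!: sum.cong)

lemma index_mult_mat_vec_sum:
  assumes "M \<in> carrier_mat p q" "v \<in> carrier_vec q" "a < p"
  shows "vec_index (M *\<^sub>v v) a = (\<Sum>c<q. M $$ (a, c) * vec_index v c)"
  using assms by (auto simp: scalar_prod_def atLeast0LessThan intro!: sum.cong)

lemma mult_unit_vec_index:
  fixes M :: "complex mat"
  assumes "M \<in> carrier_mat q m" "a < q" "k < m"
  shows "vec_index (M *\<^sub>v unit_vec m k) a = M $$ (a, k)"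
proof -
  have "vec_index (M *\<^sub>v unit_vec m k) a = (\<Sum>c<m. M $$ (a, c) * vec_index (unit_vec m k) c)"
    using assms by (intro index_mult_mat_vec_sum) auto
  also have "\<dots> = (\<Sum>c<m. if c = k then M $$ (a, c) else 0)"
    using assms by (intro sum.cong) (auto simp: unit_vec_def)
  finally show ?thesis using assms(3) by (simp only: sum.delta finite_lessThan lessThan_iff if_True)
qed

lemma sum_lessThan_add:
  fixes F :: "nat \<Rightarrow> 'b::comm_monoid_add"
  shows "(\<Sum>c<m + k. F c) = (\<Sum>c<m. F c) + (\<Sum>c<k. F (m + c))"
  by (induction k) (simp_all add: add.assoc)

lemma sum_lessThan_twice:
  fixes F :: "nat \<Rightarrow> 'b::comm_monoid_add"
  shows "(\<Sum>c<2 * m. F c) = (\<Sum>c<m. F c) + (\<Sum>c<m. F (m + c))"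
  using sum_lessThan_add[of F m m] by (simp add: mult_2)

lemma symbol_identity_index:
  assumes "M \<in> carrier_mat m (2 * m)" "M * jet_incl 1 m = 1\<^sub>m m" "a < m" "b < m"
  shows "M $$ (a, m + b) = (if a = b then 1 else 0)"
proof -
  have "(M * jet_incl 1 m) $$ (a, b) = (\<Sum>c<2 * m. M $$ (a, c) * jet_incl 1 m $$ (c, b))"
    using assms by (intro index_mult_mat_sum) (auto simp: jet_incl_def)
  also have "\<dots> = (\<Sum>c<2 * m. if c = m + b then M $$ (a, c) else 0)"
    using assms(4) by (intro sum.cong) (auto simp: jet_incl_def)
  also have "\<dots> = M $$ (a, m + b)"
    using assms(4) by simp
  finally show ?thesis
    using assms by simp
qed

text \<open>Cramer's rule for the identity matrix.\<close>

lemma wedge_unit_vec_update: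
  assumes "v \<in> carrier_vec n" "k < n"
  shows "wedge n ((unit_vec n)(k := v)) = vec_index v k"
proof -
  have "Matrix.mat n n (\<lambda>(a, b). vec_index (((unit_vec n)(k := v)) b) a)
      = replace_col (1\<^sub>m n) (1\<^sub>m n *\<^sub>v v) k"
    using assms by (auto simp: replace_col_def unit_vec_def intro!: eq_matI)
  then show ?thesis
    unfolding wedge_def using cramer_lemma_mat[of "1\<^sub>m n" n v k] assms by simp
qed

text \<open>
  The splitting \<open>D1\<close> completes a jet \<open>(c\<^sub>0, \<dots>, c\<^sub>n\<^sub>-\<^sub>1)\<close> by the \<open>c\<^sub>n\<close> solving \<open>\<rho> c = 0\<close>. As
  \<open>D\<close> annihilates the image under \<open>h\<close> of the completed jets, its zeroth order part is minus the map
  \<open>(c\<^sub>0, \<dots>, c\<^sub>n\<^sub>-\<^sub>1) \<mapsto> (c\<^sub>1, 2 c\<^sub>2, \<dots>, n c\<^sub>n)\<close>, in whose matrix only the last row has a diagonal entry.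
\<close>

lemma companion_trace:
  assumes n: "n > 0"
    and carrier: "\<rho> \<in> carrier_mat 1 (n + 1)" "D1 \<in> carrier_mat (n + 1) n"
      "h \<in> carrier_mat (2 * n) (n + 1)" "D \<in> carrier_mat n (2 * n)"
    and D1: "\<rho> * D1 = 0\<^sub>m 1 n" "jet_trunc n 1 * D1 = 1\<^sub>m n"
    and h0: "\<And>p k. p < n \<Longrightarrow> k \<le> n \<Longrightarrow> h $$ (p, k) = (if p = k then 1 else 0)"
    and h1: "\<And>p k. p < n \<Longrightarrow> k \<le> n \<Longrightarrow> h $$ (n + p, k) = (if Suc p = k then of_nat (Suc p) else 0)"
    and D: "D * (h * D1) = 0\<^sub>m n n" "D * jet_incl 1 n = 1\<^sub>m n"
    and symbol: "\<rho> $$ (0, n) \<noteq> 0"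
  shows "(\<Sum>k<n. D $$ (k, k)) = of_nat n * \<rho> $$ (0, n - 1) / \<rho> $$ (0, n)"
proof -
  have D1_top: "D1 $$ (a, b) = (if a = b then 1 else 0)" if "a < n" "b < n" for a b
  proof -
    have "(jet_trunc n 1 * D1) $$ (a, b) = (\<Sum>c<n + 1. jet_trunc n 1 $$ (a, c) * D1 $$ (c, b))"
      using carrier that by (intro index_mult_mat_sum) (auto simp: jet_trunc_def)
    also have "\<dots> = (\<Sum>c<n + 1. if c = a then D1 $$ (c, b) else 0)"
      using that by (intro sum.cong) (auto simp: jet_trunc_def)
    finally show ?thesis using D1(2) that by simp
  qed
  have D1_last: "D1 $$ (n, b) = - \<rho> $$ (0, b) / \<rho> $$ (0, n)" if "b < n" for b
  proof -
    have "(\<rho> * D1) $$ (0, b) = (\<Sum>c<n + 1. \<rho> $$ (0, c) * D1 $$ (c, b))"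
      using carrier that by (intro index_mult_mat_sum) auto
    also have "\<dots> = (\<Sum>c<n. if c = b then \<rho> $$ (0, c) else 0) + \<rho> $$ (0, n) * D1 $$ (n, b)"
    proof -
      have "(\<Sum>c<n. \<rho> $$ (0, c) * D1 $$ (c, b)) = (\<Sum>c<n. if c = b then \<rho> $$ (0, c) else 0)"
        using that D1_top by (intro sum.cong) auto
      then show ?thesis by simp
    qed
    finally have "\<rho> $$ (0, b) + \<rho> $$ (0, n) * D1 $$ (n, b) = 0"
      using D1(1) that by simp
    then show ?thesis using symbol by (simp add: field_simps add_eq_0_iff)
  qed
  have hD1: "(h * D1) $$ (p, b) = D1 $$ (p, b)"
    "(h * D1) $$ (n + p, b) = of_nat (Suc p) * D1 $$ (Suc p, b)" if "p < n" "b < n" for p b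
  proof -
    have "(h * D1) $$ (p, b) = (\<Sum>c<n + 1. h $$ (p, c) * D1 $$ (c, b))"
      using carrier that by (intro index_mult_mat_sum[where p = "2 * n"]) auto
    also have "\<dots> = (\<Sum>c<n + 1. if c = p then D1 $$ (c, b) else 0)"
      using that h0 by (intro sum.cong) auto
    finally show "(h * D1) $$ (p, b) = D1 $$ (p, b)" using that by simp
    have "(h * D1) $$ (n + p, b) = (\<Sum>c<n + 1. h $$ (n + p, c) * D1 $$ (c, b))"
      using carrier that by (intro index_mult_mat_sum[where p = "2 * n"]) auto
    also have "\<dots> = (\<Sum>c<n + 1. if c = Suc p then of_nat (Suc p) * D1 $$ (c, b) else 0)"
      using that h1 by (intro sum.cong) auto
    finally show "(h * D1) $$ (n + p, b) = of_nat (Suc p) * D1 $$ (Suc p, b)" using that by simp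
  qed
  have "D $$ (k, k) = - of_nat (Suc k) * D1 $$ (Suc k, k)" if k: "k < n" for k
  proof -
    have "(D * (h * D1)) $$ (k, k) = (\<Sum>c<2 * n. D $$ (k, c) * (h * D1) $$ (c, k))"
      using carrier k by (intro index_mult_mat_sum) auto
    also have "\<dots> = (\<Sum>c<n. D $$ (k, c) * D1 $$ (c, k))
        + (\<Sum>c<n. D $$ (k, n + c) * (of_nat (Suc c) * D1 $$ (Suc c, k)))"
      unfolding sum_lessThan_twice using hD1 k by (intro arg_cong2[of _ _ _ _ "(+)"] sum.cong) auto
    also have "(\<Sum>c<n. D $$ (k, c) * D1 $$ (c, k)) = (\<Sum>c<n. if c = k then D $$ (k, c) else 0)"
      using D1_top k by (intro sum.cong) auto
    also have "(\<Sum>c<n. D $$ (k, n + c) * (of_nat (Suc c) * D1 $$ (Suc c, k)))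
        = (\<Sum>c<n. if c = k then of_nat (Suc c) * D1 $$ (Suc c, k) else 0)"
      using symbol_identity_index[OF carrier(4) D(2) k] by (intro sum.cong) auto
    finally have "D $$ (k, k) + of_nat (Suc k) * D1 $$ (Suc k, k) = 0"
      using D(1) k by simp
    then show ?thesis by (simp only: mult_minus_left eq_neg_iff_add_eq_0)
  qed
  then have "(\<Sum>k<n. D $$ (k, k)) = (\<Sum>k<n. - of_nat (Suc k) * D1 $$ (Suc k, k))"
    by (intro sum.cong) auto
  also have "\<dots> = (\<Sum>k<n. if k = n - 1 then - of_nat n * D1 $$ (n, n - 1) else 0)"
    using D1_top n by (intro sum.cong) (auto simp: Suc_lessI)
  also have "\<dots> = of_nat n * \<rho> $$ (0, n - 1) / \<rho> $$ (0, n)"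
    using n D1_last[of "n - 1"] by simp
  finally show ?thesis .
qed

context riemann_charts
begin

lemma first_order_apply:
  assumes ix: "i \<in> Idx X" "x \<in> Dom X i" and M: "M \<in> carrier_mat q (2 * m)" "a < q"
  shows "vec_index (M *\<^sub>v jet X i 1 m s x) a = (\<Sum>b<m. M $$ (a, b) * vec_index (s x) b)
    + (\<Sum>b<m. M $$ (a, m + b) * tcoeff X i x 1 (\<lambda>y. vec_index (s y) b))"
proof -
  have "vec_index (M *\<^sub>v jet X i 1 m s x) a
      = (\<Sum>c<2 * m. M $$ (a, c) * vec_index (jet X i 1 m s x) c)"
    using M by (intro index_mult_mat_vec_sum) (auto simp: jet_def)
  also have "\<dots> = (\<Sum>b<m. M $$ (a, b) * vec_index (s x) b)
    + (\<Sum>b<m. M $$ (a, m + b) * tcoeff X i x 1 (\<lambda>y. vec_index (s y) b))"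
    unfolding sum_lessThan_twice
    by (intro arg_cong2[of _ _ _ _ "(+)"] sum.cong)
      (auto simp: jet_def tcoeff_def cinv_crd[OF ix])
  finally show ?thesis .
qed

lemma connection_apply:
  assumes ix: "i \<in> Idx X" "x \<in> Dom X i" and M: "M \<in> carrier_mat m (2 * m)" "a < m"
    and symbol: "M * jet_incl 1 m = 1\<^sub>m m"
  shows "vec_index (M *\<^sub>v jet X i 1 m s x) a
    = (\<Sum>b<m. M $$ (a, b) * vec_index (s x) b) + tcoeff X i x 1 (\<lambda>y. vec_index (s y) a)"
proof -
  have "(\<Sum>b<m. M $$ (a, m + b) * tcoeff X i x 1 (\<lambda>y. vec_index (s y) b))
      = (\<Sum>b<m. if b = a then tcoeff X i x 1 (\<lambda>y. vec_index (s y) b) else 0)"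
    using symbol_identity_index[OF M(1) symbol M(2)] by (intro sum.cong) auto
  then show ?thesis
    unfolding first_order_apply[OF ix M] using M(2) by simp
qed

definition crd_power :: "'i \<Rightarrow> 'a \<Rightarrow> nat \<Rightarrow> 'a \<Rightarrow> complex Matrix.vec" where
  "crd_power i x k y = Matrix.vec 1 (\<lambda>_. (crd X i y - crd X i x) ^ k)"

lemma local_section_crd_power:
  "i \<in> Idx X \<Longrightarrow> local_section X i 1 (Dom X i) (crd_power i x k)"
  using chart(1) holo_on_crd_power by (auto simp: local_section_def crd_power_def)

lemma tcoeff_crd_power:
  assumes "i \<in> Idx X" "x \<in> Dom X i"
  shows "tcoeff X i x p (\<lambda>y. vec_index (crd_power i x k y) 0) = (if p = k then 1 else 0)"
  using assms
  by (simp add: crd_power_def tcoeff_eq_taylor taylor_power taylor_crd fps_X_power_nth)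

lemma jet_crd_power:
  assumes "i \<in> Idx X" "x \<in> Dom X i"
  shows "jet X i n 1 (crd_power i x k) x = unit_vec (n + 1) k"
  using tcoeff_crd_power[OF assms] by (intro eq_vecI) (auto simp: jet_def unit_vec_def)

lemma mult_jet_crd_power:
  assumes "i \<in> Idx X" "x \<in> Dom X i" "M \<in> carrier_mat q (n + 1)" "a < q" "k \<le> n"
  shows "vec_index (M *\<^sub>v jet X i n 1 (crd_power i x k) x) a = M $$ (a, k)"
  unfolding jet_crd_power[OF assms(1,2)] using assms(5) by (intro mult_unit_vec_index[OF assms(3,4)]) simp

lemma jet_embedding_index:
  assumes h: "is_jet_embedding X n V h" and ix: "i \<in> Idx X" "x \<in> Dom X i"
    and pk: "p < n" "k \<le> n"
  shows "h i x $$ (p, k) = (if p = k then 1 else 0)"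
    and "h i x $$ (n + p, k) = (if Suc p = k then of_nat (Suc p) else 0)"
proof -
  let ?s = "crd_power i x k"
  have carrier: "h i x \<in> carrier_mat (2 * n) (n + 1)"
    using h ix by (auto simp: is_jet_embedding_def bundle_hom_def)
  have eq: "h i x *\<^sub>v jet X i n 1 ?s x = jet X i 1 n (jet X i (n - 1) 1 ?s) x"
    using h ix local_section_crd_power[OF ix(1)] unfolding is_jet_embedding_def by blast
  have "holo_at X i x (\<lambda>y. vec_index (?s y) 0)"
    using ix by (simp add: crd_power_def taylor_power taylor_crd)
  note d = tcoeff_tcoeff(1)[OF ix this]
  have "vec_index (jet X i 1 n (jet X i (n - 1) 1 ?s) x) p = (if p = k then 1 else 0)"
    using pk ix tcoeff_crd_power[OF ix] by (simp add: jet_def tcoeff_def[of X i x 0] cinv_crd)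
  then show "h i x $$ (p, k) = (if p = k then 1 else 0)"
    using mult_jet_crd_power[OF ix carrier, of p k] pk eq by simp
  have "vec_index (jet X i 1 n (jet X i (n - 1) 1 ?s) x) (n + p)
      = (if Suc p = k then of_nat (Suc p) else 0)"
    using pk ix tcoeff_crd_power[OF ix, of "Suc p" k] d[of p] by (auto simp: jet_def)
  then show "h i x $$ (n + p, k) = (if Suc p = k then of_nat (Suc p) else 0)"
    using mult_jet_crd_power[OF ix carrier, of "n + p" k] pk eq by simp
qed

text \<open>
  The induced connection is tested on the standard frame with its first vector multiplied by a
  function \<open>\<phi>\<close>. If \<open>\<phi>(x) = 1\<close>, then at \<open>x\<close> one is left with the standard frame, each summand is a
  diagonal entry, and the first one has \<open>\<phi>'(x)\<close> in addition. The values \<open>0\<close> and \<open>1\<close> of \<open>\<phi>'(x)\<close>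
  separate the two entries of the operator.
\<close>

lemma induced_det_connection_index:
  assumes n: "n > 0" and ix: "i \<in> Idx X" "x \<in> Dom X i"
    and D: "D i x \<in> carrier_mat n (2 * n)" "D i x * jet_incl 1 n = 1\<^sub>m n"
    and C: "induced_det_connection X n D C"
  shows "C i x $$ (0, 0) = (\<Sum>k<n. D i x $$ (k, k))" and "C i x $$ (0, 1) = 1"
proof -
  have C_apply: "C i x $$ (0, 0) + C i x $$ (0, 1) * e = (\<Sum>k<n. D i x $$ (k, k)) + e"
    if e: "e \<in> {0, 1}" for e
  proof -
    define \<phi> where "\<phi> = (\<lambda>y. 1 + e * (crd X i y - crd X i x))"
    define s where "s = (\<lambda>k y. (if k = 0 then \<phi> y else 1) \<cdot>\<^sub>v unit_vec n k)"
    have \<phi>x: "\<phi> x = 1" by (simp add: \<phi>_def)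
    have sx: "s k x = unit_vec n k" for k by (simp add: s_def \<phi>x)
    have \<phi>_holo: "holo_on X (Dom X i) \<phi>"
      using holo_on_crd[OF ix(1)] unfolding \<phi>_def holo_on_def o_def
      by (auto intro!: holomorphic_intros)
    have taylor_\<phi>: "taylor X i x \<phi> = 1 + fps_const e * fps_X"
      unfolding \<phi>_def using ix by (simp add: taylor_add taylor_mult taylor_const taylor_crd)
    have frame: "local_section X i n (Dom X i) (s k)" for k
      using chart(1)[OF ix(1)] \<phi>_holo holo_on_const
      by (cases "k = 0") (auto simp: local_section_def s_def unit_vec_def)
    have wedge_s: "wedge n (\<lambda>k. s k y) = \<phi> y" for y
    proof -
      have "(\<lambda>k. s k y) = (unit_vec n)(0 := \<phi> y \<cdot>\<^sub>v unit_vec n 0)"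
        by (auto simp: s_def)
      then show ?thesis using n by (simp add: wedge_unit_vec_update)
    qed
    have carrier: "C i x \<in> carrier_mat 1 (2 * 1)"
      using C ix by (auto simp: induced_det_connection_def)
    have "vec_index (C i x *\<^sub>v jet X i 1 1 (\<lambda>y. Matrix.vec 1 (\<lambda>_. \<phi> y)) x) 0
        = (\<Sum>k<n. wedge n ((\<lambda>b. s b x)(k := D i x *\<^sub>v jet X i 1 n (s k) x)))"
      using C ix frame unfolding induced_det_connection_def wedge_s[symmetric] by blast
    also have "\<dots> = (\<Sum>k<n. D i x $$ (k, k) + (if k = 0 then e else 0))"
    proof (intro sum.cong refl)
      fix k assume "k \<in> {..<n}"
      then have k: "k < n" by simp
      have apply_s: "vec_index (D i x *\<^sub>v jet X i 1 n (s k) x) k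
          = (\<Sum>b<n. D i x $$ (k, b) * vec_index (unit_vec n k) b)
            + tcoeff X i x 1 (\<lambda>y. vec_index (s k y) k)"
        using connection_apply[OF ix D(1) k D(2), of "s k"] unfolding sx .
      have "(\<Sum>b<n. D i x $$ (k, b) * vec_index (unit_vec n k) b)
          = (\<Sum>b<n. if b = k then D i x $$ (k, b) else 0)"
        using k by (intro sum.cong) (auto simp: unit_vec_def)
      then have zeroth: "(\<Sum>b<n. D i x $$ (k, b) * vec_index (unit_vec n k) b) = D i x $$ (k, k)"
        using k by simp
      have first: "tcoeff X i x 1 (\<lambda>y. vec_index (s k y) k) = (if k = 0 then e else 0)"
        using k taylor_\<phi> by (auto simp: s_def tcoeff_eq_taylor taylor_const)
      note diagonal = apply_s[unfolded zeroth first]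
      have "D i x *\<^sub>v jet X i 1 n (s k) x \<in> carrier_vec n"
        using D(1) by (intro carrier_vecI) simp
      from wedge_unit_vec_update[OF this k] diagonal
      show "wedge n ((\<lambda>b. s b x)(k := D i x *\<^sub>v jet X i 1 n (s k) x))
          = D i x $$ (k, k) + (if k = 0 then e else 0)"
        unfolding sx by (rule trans)
    qed
    also have "\<dots> = (\<Sum>k<n. D i x $$ (k, k)) + e"
      using n by (simp add: sum.distrib)
    finally show ?thesis
      using first_order_apply[OF ix carrier, of 0 "\<lambda>y. Matrix.vec 1 (\<lambda>_. \<phi> y)"]
      by (simp add: \<phi>x tcoeff_eq_taylor taylor_\<phi>)
  qed
  from C_apply[of 0] C_apply[of 1]
  show "C i x $$ (0, 0) = (\<Sum>k<n. D i x $$ (k, k))" "C i x $$ (0, 1) = 1" by auto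
qed

end

section \<open>Trivial connections on line bundles\<close>

lemma scalar_index [simp]: "scalar c $$ (0, 0) = c"
  and scalar_dim [simp]: "dim_row (scalar c) = 1" "dim_col (scalar c) = 1"
  and scalar_carrier [simp]: "scalar c \<in> carrier_mat 1 1"
  by (simp_all add: scalar_def)

lemma fps_mult_power_nth:
  fixes F H :: "complex fps"
  assumes "fps_nth H 0 = 0" "p \<le> q"
  shows "fps_nth (F * H ^ q) p = (if p = q then fps_nth F 0 * fps_nth H 1 ^ q else 0)"
proof -
  have "fps_nth (H ^ q) k = 0" if "k < q" for k
    using startsby_zero_power_prefix[OF assms(1), of q] that by blast
  then have "fps_nth (F * H ^ q) p
      = (\<Sum>k=0..p. if k = 0 then (if p = q then fps_nth F 0 * fps_nth (H ^ q) q else 0) else 0)"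
    unfolding fps_mult_nth using assms(2) by (intro sum.cong) auto
  then show ?thesis
    using startsby_zero_power_nth_same[OF assms(1), of q] by simp
qed

context riemann_charts
begin

lemma taylor_other_crd:
  assumes "i \<in> Idx X" "j \<in> Idx X" "x \<in> Dom X i" "x \<in> Dom X j"
  shows "holo_at X i x (\<lambda>y. crd X j y - crd X j x)"
    and "fps_nth (taylor X i x (\<lambda>y. crd X j y - crd X j x)) 0 = 0"
    and "fps_nth (taylor X i x (\<lambda>y. crd X j y - crd X j x)) 1 = canon X i j x"
  using taylor_change_of_chart[OF assms taylor_crd(2)] taylor_crd(1)[of j x] assms
  by (auto simp: taylor_nth_0)

text \<open>A flat section and the flat frame \<open>u\<close> solve the same linear equation of first order.\<close>

lemma flat_section_ratio_locally_constant:
  assumes u: "\<And>i. i \<in> Idx X \<Longrightarrow> holo_on X (Dom X i) (u i)"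
      "\<And>i x. i \<in> Idx X \<Longrightarrow> x \<in> Dom X i \<Longrightarrow> u i x \<noteq> 0"
    and C: "\<And>i x. i \<in> Idx X \<Longrightarrow> x \<in> Dom X i \<Longrightarrow> C i x \<in> carrier_mat 1 2"
      "\<And>i x. i \<in> Idx X \<Longrightarrow> x \<in> Dom X i \<Longrightarrow> C i x $$ (0, 1) = 1"
      "\<And>i x. i \<in> Idx X \<Longrightarrow> x \<in> Dom X i \<Longrightarrow> C i x $$ (0, 0) * u i x + tcoeff X i x 1 (u i) = 0"
    and s: "flat_section X 1 G C S s" and i: "i \<in> Idx X" and x: "x \<in> S" "x \<in> Dom X i"
  shows "\<forall>\<^sub>F y in nhds x. y \<in> S \<and> y \<in> Dom X i \<and>
    vec_index (s i y) 0 / u i y = vec_index (s i x) 0 / u i x"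
proof -
  define q where "q = (\<lambda>y. vec_index (s i y) 0 / u i y)"
  define T where "T = crd X i ` (S \<inter> Dom X i)"
  have S: "open S" and s_holo: "holo_on X (S \<inter> Dom X i) (\<lambda>y. vec_index (s i y) 0)"
    using s i by (auto simp: flat_section_def holo_section_def)
  have T: "open T"
    unfolding T_def using S chart(1)[OF i] i by (intro open_crd_image) auto
  have deriv_q: "((q \<circ> cinv X i) has_field_derivative 0) (at w)" if w: "w \<in> T" for w
  proof -
    obtain y where y: "y \<in> S" "y \<in> Dom X i" "w = crd X i y" using w by (auto simp: T_def)
    have hu: "holo_at X i y (u i)"
      using holo_on_imp_holo_at[OF i y(2,2) chart(1)[OF i] u(1)[OF i]] .
    have hs: "holo_at X i y (\<lambda>y. vec_index (s i y) 0)"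
      using holo_on_imp_holo_at[OF i _ y(2) _ s_holo] y S chart(1)[OF i] by auto
    have "((u i \<circ> cinv X i) has_field_derivative tcoeff X i y 1 (u i)) (at w)"
      using hu analytic_on_imp_differentiable_at[of "u i \<circ> cinv X i" "{w}" w]
      by (simp add: holo_at_def tcoeff_def y(3) DERIV_deriv_iff_field_differentiable)
    moreover have "(((\<lambda>y. vec_index (s i y) 0) \<circ> cinv X i)
        has_field_derivative tcoeff X i y 1 (\<lambda>y. vec_index (s i y) 0)) (at w)"
      using hs analytic_on_imp_differentiable_at[of "(\<lambda>y. vec_index (s i y) 0) \<circ> cinv X i" "{w}" w]
      by (simp add: holo_at_def tcoeff_def y(3) DERIV_deriv_iff_field_differentiable)
    moreover have cy: "cinv X i w = y" using y cinv_crd[OF i] by simp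
    ultimately have "((q \<circ> cinv X i) has_field_derivative
        (tcoeff X i y 1 (\<lambda>y. vec_index (s i y) 0) * u i y
          - vec_index (s i y) 0 * tcoeff X i y 1 (u i)) / (u i y * u i y)) (at w)"
      using DERIV_divide[of "(\<lambda>y. vec_index (s i y) 0) \<circ> cinv X i" _ w UNIV "u i \<circ> cinv X i"] u(2)[OF i y(2)]
      by (simp add: q_def o_def)
    moreover have "C i y $$ (0, 0) * vec_index (s i y) 0 + tcoeff X i y 1 (\<lambda>y. vec_index (s i y) 0) = 0"
    proof -
      have "vec_index (C i y *\<^sub>v jet X i 1 1 (s i) y) 0 = 0"
        using s i y by (auto simp: flat_section_def)
      then show ?thesis
        using first_order_apply[OF i y(2), of "C i y" 1 1 0 "s i"] C(1,2)[OF i y(2)] by simp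
    qed
    then have "tcoeff X i y 1 (\<lambda>y. vec_index (s i y) 0) * u i y - vec_index (s i y) 0 * tcoeff X i y 1 (u i) = 0"
    proof -
      assume "C i y $$ (0, 0) * vec_index (s i y) 0 + tcoeff X i y 1 (\<lambda>y. vec_index (s i y) 0) = 0"
      then have "tcoeff X i y 1 (\<lambda>y. vec_index (s i y) 0) = - (C i y $$ (0, 0) * vec_index (s i y) 0)"
        by (metis add.inverse_unique)
      moreover have "tcoeff X i y 1 (u i) = - (C i y $$ (0, 0) * u i y)"
        using C(3)[OF i y(2)] by (metis add.inverse_unique)
      ultimately show ?thesis by simp
    qed
    ultimately show ?thesis by simp
  qed
  obtain e where e: "e > 0" "ball (crd X i x) e \<subseteq> T"
    using T x by (metis IntI T_def imageI openE)
  have "\<exists>c. \<forall>w\<in>ball (crd X i x) e. (q \<circ> cinv X i) w = c"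
  proof (rule has_field_derivative_zero_constant)
    show "((q \<circ> cinv X i) has_field_derivative 0) (at w within ball (crd X i x) e)"
      if "w \<in> ball (crd X i x) e" for w
      by (rule has_field_derivative_at_within[OF deriv_q]) (use e(2) that in blast)
  qed simp
  then obtain c where c: "\<And>w. w \<in> ball (crd X i x) e \<Longrightarrow> q (cinv X i w) = c" by auto
  have "continuous_on (Dom X i) (crd X i)"
    using chart(3)[OF i] by (simp add: homeomorphism_def)
  then have "isCont (crd X i) x"
    using chart(1)[OF i] x(2) continuous_on_eq_continuous_at by blast
  then have "filterlim (crd X i) (nhds (crd X i x)) (nhds x)"
    by (simp add: isCont_def tendsto_nhds_iff)
  then have "\<forall>\<^sub>F y in nhds x. crd X i y \<in> ball (crd X i x) e"
    using e(1) by (intro topological_tendstoD) auto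
  moreover have "\<forall>\<^sub>F y in nhds x. y \<in> S" "\<forall>\<^sub>F y in nhds x. y \<in> Dom X i"
    using S chart(1)[OF i] x by (auto intro: eventually_nhds_in_open)
  ultimately show ?thesis
  proof eventually_elim
    case (elim y)
    have "q y = c" using c[OF elim(1)] cinv_crd[OF i elim(3)] by simp
    moreover have "q x = c" using c[of "crd X i x"] cinv_crd[OF i x(2)] e(1) by simp
    ultimately show ?case using elim by (simp add: q_def)
  qed
qed

text \<open>
  If the bundle is trivialised by a nowhere vanishing section \<open>u\<close> which is flat, then a parallel
  field along a curve is a constant multiple of \<open>u\<close>, and hence returns to itself along a loop.
\<close>

lemma trivial_connection_if_flat_frame:
  assumes u: "\<And>i. i \<in> Idx X \<Longrightarrow> holo_on X (Dom X i) (u i)"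
      "\<And>i x. i \<in> Idx X \<Longrightarrow> x \<in> Dom X i \<Longrightarrow> u i x \<noteq> 0"
    and G: "\<And>i j x. i \<in> Idx X \<Longrightarrow> j \<in> Idx X \<Longrightarrow> x \<in> Dom X i \<inter> Dom X j \<Longrightarrow>
        G i j x = scalar (u i x / u j x)"
    and C: "\<And>i x. i \<in> Idx X \<Longrightarrow> x \<in> Dom X i \<Longrightarrow> C i x \<in> carrier_mat 1 2"
      "\<And>i x. i \<in> Idx X \<Longrightarrow> x \<in> Dom X i \<Longrightarrow> C i x $$ (0, 1) = 1"
      "\<And>i x. i \<in> Idx X \<Longrightarrow> x \<in> Dom X i \<Longrightarrow> C i x $$ (0, 0) * u i x + tcoeff X i x 1 (u i) = 0"
  shows "trivial_connection X G C"
proof -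
  have u_at: "holo_at X i x (u i)" if "i \<in> Idx X" "x \<in> Dom X i" for i x
    using that chart(1) u(1) by (intro holo_on_imp_holo_at)
  have C00: "C i x $$ (0, 0) = - tcoeff X i x 1 (u i) / u i x" if "i \<in> Idx X" "x \<in> Dom X i" for i x
    using C(3)[OF that] u(2)[OF that] by (simp add: field_simps add_eq_0_iff)
  have C_holo: "holo_on X (Dom X i) (\<lambda>x. C i x $$ (a, b))" if i: "i \<in> Idx X" and "a < 1" "b < 2" for i a b
  proof (rule holo_on_if_holo_at[OF i order_refl])
    fix x assume x: "x \<in> Dom X i"
    have ev: "\<forall>\<^sub>F y in nhds x. y \<in> Dom X i"
      using chart(1)[OF i] x by (rule eventually_nhds_in_open)
    show "holo_at X i x (\<lambda>x. C i x $$ (a, b))"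
    proof (cases "b = 0")
      case True
      have quotient: "holo_at X i x (\<lambda>y. - tcoeff X i y 1 (u i) / u i y)"
        using tcoeff_tcoeff(2)[OF i x u_at[OF i x]] u_at[OF i x] u(2)[OF i x] cinv_crd[OF i x]
        unfolding holo_at_def o_def by (intro analytic_intros) auto
      have "\<forall>\<^sub>F y in nhds x. - tcoeff X i y 1 (u i) / u i y = C i y $$ (a, b)"
        using ev by (rule eventually_mono) (use C00 i that True in auto)
      then show ?thesis by (rule holo_at_cong[OF i x _ quotient])
    next
      case False
      then have "\<forall>\<^sub>F y in nhds x. 1 = C i y $$ (a, b)"
        using that C(2)[OF i] by (intro eventually_mono[OF ev]) (auto simp: less_2_cases_iff)
      then show ?thesis by (rule holo_at_cong[OF i x _ taylor_const(2)])
    qed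
  qed
  have compatible: "C i x * jet_bundle X 1 1 G i j x = twist G (canon X) 1 i j x * C j x"
    if i: "i \<in> Idx X" and j: "j \<in> Idx X" and x: "x \<in> Dom X i \<inter> Dom X j" for i j x
  proof -
    have xi: "x \<in> Dom X i" and xj: "x \<in> Dom X j" using x by auto
    define g where "g = (\<lambda>y. u i y / u j y)"
    define H where "H = taylor X i x (\<lambda>y. crd X j y - crd X j x)"
    have uj_at: "holo_at X i x (u j)"
      and uj: "fps_nth (taylor X i x (u j)) 1 = fps_nth (taylor X j x (u j)) 1 * canon X i j x"
      using taylor_change_of_chart[OF i j xi xj u_at[OF j xj]] by auto
    have g_at: "holo_at X i x g"
      using u_at[OF i xi] uj_at u(2)[OF j xj] cinv_crd[OF i xi]
      unfolding holo_at_def o_def g_def by (intro analytic_intros) auto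
    have ev: "\<forall>\<^sub>F y in nhds x. y \<in> Dom X i \<inter> Dom X j"
      using chart(1) i j x by (intro eventually_nhds_in_open) auto
    have "taylor X i x (\<lambda>y. g y * u j y) = taylor X i x (u i)"
      by (rule taylor_cong[OF i xi eventually_mono[OF ev]]) (use u(2)[OF j] in \<open>auto simp: g_def\<close>)
    then have "taylor X i x g * taylor X i x (u j) = taylor X i x (u i)"
      using taylor_mult(1)[OF g_at uj_at] by simp
    then have g': "g x * fps_nth (taylor X i x (u j)) 1 + fps_nth (taylor X i x g) 1 * u j x
        = fps_nth (taylor X i x (u i)) 1"
      by (metis fps_mult_nth_1 taylor_nth_0[OF i xi])
    have "taylor X i x (\<lambda>y. G i j y $$ (0, 0) * (crd X j y - crd X j x) ^ q) = taylor X i x g * H ^ q" for q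
    proof -
      have "taylor X i x (\<lambda>y. G i j y $$ (0, 0) * (crd X j y - crd X j x) ^ q)
          = taylor X i x (\<lambda>y. g y * (crd X j y - crd X j x) ^ q)"
        by (rule taylor_cong[OF i xi eventually_mono[OF ev]]) (use G i j in \<open>auto simp: g_def\<close>)
      then show ?thesis
        using taylor_mult(1)[OF g_at taylor_power(2)] taylor_power(1)[OF taylor_other_crd(1)[OF i j xi xj]]
          taylor_other_crd(1)[OF i j xi xj] by (simp add: H_def)
    qed
    then have J: "jet_bundle X 1 1 G i j x $$ (p, q) = fps_nth (taylor X i x g * H ^ q) p"
      if "p < 2" "q < 2" for p q
      using that by (simp add: jet_bundle_def tcoeff_eq_taylor)
    have J_carrier: "jet_bundle X 1 1 G i j x \<in> carrier_mat 2 2"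
      by (simp add: jet_bundle_def numeral_2_eq_2)
    have H: "fps_nth H 0 = 0" "fps_nth H 1 = canon X i j x"
      using taylor_other_crd[OF i j xi xj] by (simp_all add: H_def)
    have twist: "twist G (canon X) 1 i j x = scalar (canon X i j x * g x)"
      using G[OF i j x] by (auto simp: twist_def g_def scalar_def)
    have left: "(C i x * jet_bundle X 1 1 G i j x) $$ (0, q)
        = C i x $$ (0, 0) * fps_nth (taylor X i x g * H ^ q) 0 + fps_nth (taylor X i x g * H ^ q) 1"
      if "q < 2" for q
      using that index_mult_mat_sum[OF C(1)[OF i xi] J_carrier, of 0 q] C(2)[OF i xi]
        J[of 0 q] J[of 1 q] by (simp add: numeral_2_eq_2)
    have right: "(twist G (canon X) 1 i j x * C j x) $$ (0, q) = canon X i j x * g x * C j x $$ (0, q)"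
      if "q < 2" for q
      unfolding twist using that index_mult_mat_sum[OF scalar_carrier C(1)[OF j xj], of 0 q] by simp
    have "C i x $$ (0, 0) * g x + fps_nth (taylor X i x g) 1 = canon X i j x * g x * C j x $$ (0, 0)"
    proof -
      have "(C i x $$ (0, 0) * g x + fps_nth (taylor X i x g) 1) * u j x
          = C i x $$ (0, 0) * u i x + fps_nth (taylor X i x g) 1 * u j x"
        using u(2)[OF j xj] by (simp add: g_def field_simps)
      also have "\<dots> = - g x * fps_nth (taylor X i x (u j)) 1"
        using C(3)[OF i xi] g' by (simp add: tcoeff_eq_taylor algebra_simps add_eq_0_iff)
      also have "\<dots> = canon X i j x * g x * C j x $$ (0, 0) * u j x"
      proof -
        have "fps_nth (taylor X j x (u j)) 1 = - (C j x $$ (0, 0) * u j x)"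
          using C(3)[OF j xj] unfolding tcoeff_eq_taylor by (metis add.inverse_unique)
        then show ?thesis unfolding uj by simp
      qed
      finally show ?thesis using u(2)[OF j xj] by simp
    qed
    then have entries: "(C i x * jet_bundle X 1 1 G i j x) $$ (0, q)
        = (twist G (canon X) 1 i j x * C j x) $$ (0, q)" if "q < 2" for q
      using that H left[OF that] right[OF that] C(2)[OF j xj] fps_mult_power_nth[OF H(1), of _ 1]
        fps_mult_power_nth[OF H(1), of 0 1]
      by (cases "q = 0") (auto simp: less_2_cases_iff taylor_nth_0[OF i xi])
    show ?thesis
    proof (rule eq_matI)
      fix p q
      assume "p < dim_row (twist G (canon X) 1 i j x * C j x)"
        and "q < dim_col (twist G (canon X) 1 i j x * C j x)"
      then have "p = 0" "q < 2"
        using C(1)[OF j xj] unfolding twist by auto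
      then show "(C i x * jet_bundle X 1 1 G i j x) $$ (p, q)
          = (twist G (canon X) 1 i j x * C j x) $$ (p, q)"
        using entries by (simp only:)
    qed (use C(1)[OF i xi] C(1)[OF j xj] J_carrier in \<open>simp_all add: twist\<close>)
  qed
  have "connection X 1 G C"
    unfolding connection_def bundle_hom_def
  proof (intro conjI ballI allI impI)
    fix i x assume ix: "i \<in> Idx X" "x \<in> Dom X i"
    show "C i x \<in> carrier_mat 1 (2 * 1)" using C(1)[OF ix] by simp
    have "(C i x * jet_incl 1 1) $$ (0, 0) = 1"
      using C(1,2)[OF ix] index_mult_mat_sum[of "C i x" 1 2 "jet_incl 1 1" 1 0 0]
      by (simp add: jet_incl_def numeral_2_eq_2)
    then show "C i x * jet_incl 1 1 = 1\<^sub>m 1"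
      using C(1)[OF ix] by (intro eq_matI) (auto simp: jet_incl_def)
  next
    fix i a b assume "i \<in> Idx X" "a < (1::nat)" "b < 2 * (1::nat)"
    then show "holo_on X (Dom X i) (\<lambda>x. C i x $$ (a, b))"
      using C_holo by simp
  qed (rule compatible)
  moreover have "trivial_monodromy X 1 G C"
    unfolding trivial_monodromy_def
  proof (intro allI impI ballI, elim conjE)
    fix \<gamma> v i
    assume \<gamma>: "path \<gamma>" "pathfinish \<gamma> = pathstart \<gamma>" and v: "parallel_along X 1 G C \<gamma> v"
      and i: "i \<in> Idx X" "pathstart \<gamma> \<in> Dom X i"
    \<comment> \<open>a frame at each time, chosen without regard to continuity\<close>
    define k where "k = (\<lambda>t. SOME i. i \<in> Idx X \<and> \<gamma> t \<in> Dom X i)"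
    have k: "k t \<in> Idx X" "\<gamma> t \<in> Dom X (k t)" for t
      using someI_ex[of "\<lambda>i. i \<in> Idx X \<and> \<gamma> t \<in> Dom X i"] chart_cover[of "\<gamma> t"]
      unfolding k_def by auto
    \<comment> \<open>the ratio of \<open>v\<close> and \<open>u\<close> does not depend on the frame\<close>
    define F where "F = (\<lambda>t. vec_index (v t (k t)) 0 / u (k t) (\<gamma> t))"
    have F: "v t j \<in> carrier_vec 1 \<and> vec_index (v t j) 0 / u j (\<gamma> t) = F t"
      if t: "t \<in> {0..1}" and j: "j \<in> Idx X" "\<gamma> t \<in> Dom X j" for t j
    proof -
      from bspec[OF iffD1[OF parallel_along_def v] t]
      obtain S s \<epsilon> where S: "flat_section X 1 G C S s" "\<epsilon> > 0"
        and near: "\<forall>t'\<in>{0..1}. \<bar>t' - t\<bar> < \<epsilon> \<longrightarrow> \<gamma> t' \<in> S \<and>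
           (\<forall>i\<in>Idx X. \<gamma> t' \<in> Dom X i \<longrightarrow> v t' i = s i (\<gamma> t'))"
        by (elim exE conjE) (rule that)
      have s: "\<gamma> t \<in> S" "v t j = s j (\<gamma> t)" "v t (k t) = s (k t) (\<gamma> t)"
        using S(2) bspec[OF near t] j k[of t] by simp_all
      have sec: "holo_section X 1 G S s"
        using S(1) unfolding flat_section_def by (elim conjE)
      have carrier: "s m (\<gamma> t) \<in> carrier_vec 1" if "m \<in> Idx X" "\<gamma> t \<in> Dom X m" for m
      proof -
        have "\<forall>m\<in>Idx X. \<forall>x\<in>S \<inter> Dom X m. s m x \<in> carrier_vec 1"
          using sec unfolding holo_section_def by (elim conjE)
        then show ?thesis using that s(1) by blast
      qed
      have cocycle: "\<forall>i\<in>Idx X. \<forall>j\<in>Idx X. \<forall>x\<in>S \<inter> Dom X i \<inter> Dom X j.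
          s i x = G i j x *\<^sub>v s j x"
        using sec unfolding holo_section_def by (elim conjE)
      have transition: "s j (\<gamma> t) = G j (k t) (\<gamma> t) *\<^sub>v s (k t) (\<gamma> t)"
        by (rule bspec[OF bspec[OF bspec[OF cocycle j(1)] k(1)]]) (use s(1) j(2) k(2)[of t] in blast)
      have "vec_index (s j (\<gamma> t)) 0 = u j (\<gamma> t) / u (k t) (\<gamma> t) * vec_index (s (k t) (\<gamma> t)) 0"
        using G[OF j(1) k(1)[of t]] j(2) k(2)[of t]
          index_mult_mat_vec_sum[OF scalar_carrier carrier[OF k], of 0]
        unfolding transition by simp
      then have "vec_index (v t j) 0 / u j (\<gamma> t) = F t"
        using u(2)[OF j] unfolding F_def s(2,3) by simp
      then show ?thesis
        using carrier[OF j] unfolding s(2) by simp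
    qed
    have "F 0 = F 1"
    proof (rule connected_local_const[of "{0..1::real}"])
      show "\<forall>t\<in>{0..1}. \<forall>\<^sub>F t' in at t within {0..1}. F t = F t'"
      proof
        fix t :: real assume t: "t \<in> {0..1}"
        from bspec[OF iffD1[OF parallel_along_def v] t]
        obtain S s \<epsilon> where S: "flat_section X 1 G C S s" "\<epsilon> > 0"
          and near: "\<forall>t'\<in>{0..1}. \<bar>t' - t\<bar> < \<epsilon> \<longrightarrow> \<gamma> t' \<in> S \<and>
             (\<forall>i\<in>Idx X. \<gamma> t' \<in> Dom X i \<longrightarrow> v t' i = s i (\<gamma> t'))"
          by (elim exE conjE) (rule that)
        have \<gamma>t: "\<gamma> t \<in> S" "v t (k t) = s (k t) (\<gamma> t)"
          using S(2) bspec[OF near t] k[of t] by simp_all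
        have lim: "(\<gamma> \<longlongrightarrow> \<gamma> t) (at t within {0..1})"
          using \<gamma>(1) t by (simp add: path_def continuous_on_def)
        have "\<forall>\<^sub>F t' in at t within {0..1}. \<gamma> t' \<in> S \<and> \<gamma> t' \<in> Dom X (k t) \<and>
            vec_index (s (k t) (\<gamma> t')) 0 / u (k t) (\<gamma> t')
              = vec_index (s (k t) (\<gamma> t)) 0 / u (k t) (\<gamma> t)"
          by (rule eventually_compose_filterlim
              [OF flat_section_ratio_locally_constant[OF u C S(1) k(1) \<gamma>t(1) k(2)] lim])
        moreover have "\<forall>\<^sub>F t' in at t within {0..1}. \<bar>t' - t\<bar> < \<epsilon>"
          using S(2) by (auto simp: eventually_at dist_real_def)
        moreover have "\<forall>\<^sub>F t' in at t within {0..1}. t' \<in> {0..1}"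
          by (simp add: eventually_at_filter)
        ultimately show "\<forall>\<^sub>F t' in at t within {0..1}. F t = F t'"
        proof eventually_elim
          case (elim t')
          then have "v t' (k t) = s (k t) (\<gamma> t')" using near k(1) by blast
          moreover have "F t = vec_index (s (k t) (\<gamma> t)) 0 / u (k t) (\<gamma> t)"
            by (simp only: F_def \<gamma>t(2))
          ultimately show ?case
            using F[OF elim(3) k(1), of t] elim(1) by metis
        qed
      qed
    qed auto
    moreover have ends: "\<gamma> 0 \<in> Dom X i" "\<gamma> 1 = \<gamma> 0"
      using i(2) \<gamma>(2) by (simp_all add: pathstart_def pathfinish_def)
    note F0 = F[of 0 i, OF _ i(1) ends(1)] and F1 = F[of 1 i, OF _ i(1), unfolded ends(2), OF _ ends(1)]
    ultimately have "vec_index (v 1 i) 0 / u i (\<gamma> 0) = vec_index (v 0 i) 0 / u i (\<gamma> 0)"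
      using F0 F1 by simp
    then have "vec_index (v 1 i) 0 = vec_index (v 0 i) 0"
      using u(2)[OF i(1) ends(1)] by simp
    moreover have "v 1 i \<in> carrier_vec 1" "v 0 i \<in> carrier_vec 1"
      using F0 F1 by simp_all
    ultimately show "v 1 i = v 0 i"
      by (intro eq_vecI) auto
  qed
  ultimately show ?thesis by (simp add: trivial_connection_def)
qed

end

section \<open>The theta characteristic and the determinant of the jet bundle\<close>

lemma scalar_mult: "scalar a * scalar b = scalar (a * b)"
  using index_mult_mat_sum[OF scalar_carrier scalar_carrier, of 0 0 a b]
  by (intro eq_matI) (simp_all del: index_mult_mat(1))

lemma scalar_inject: "scalar a = scalar b \<longleftrightarrow> a = b"
  by (metis scalar_index)

context riemann_charts
begin

lemma theta_char_holo:
  assumes "theta_char X l \<theta>" "i \<in> Idx X"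
  shows "holo_on X (Dom X i) (\<theta> i)"
proof -
  have "holo_on X (Dom X i) (\<lambda>x. scalar (\<theta> i x) $$ (0, 0))"
    using assms unfolding theta_char_def bundle_hom_def by blast
  then show ?thesis by simp
qed

lemma theta_char_nonzero:
  "theta_char X l \<theta> \<Longrightarrow> i \<in> Idx X \<Longrightarrow> x \<in> Dom X i \<Longrightarrow> \<theta> i x \<noteq> 0"
  by (simp add: theta_char_def)

lemma theta_char_transition:
  assumes "theta_char X l \<theta>" "i \<in> Idx X" "j \<in> Idx X" "x \<in> Dom X i \<inter> Dom X j"
  shows "\<theta> i x * (l i j x)\<^sup>2 = canon X i j x * \<theta> j x"
proof -
  have "scalar (\<theta> i x) * lpow l 2 i j x = lpow (canon X) 1 i j x * scalar (\<theta> j x)"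
    using assms unfolding theta_char_def bundle_hom_def by blast
  then show ?thesis by (simp add: lpow_def scalar_mult scalar_inject)
qed

lemma theta_char_cocycle:
  assumes "theta_char X l \<theta>" "i \<in> Idx X" "j \<in> Idx X"
  shows "holo_on X (Dom X i \<inter> Dom X j) (l i j)"
    and "x \<in> Dom X i \<inter> Dom X j \<Longrightarrow> l i j x \<noteq> 0"
proof -
  have l: "holo_bundle X 1 (lpow l 1)" using assms by (simp add: theta_char_def)
  have "holo_on X (Dom X i \<inter> Dom X j) (\<lambda>x. lpow l 1 i j x $$ (0, 0))"
    using l assms unfolding holo_bundle_def by blast
  then show "holo_on X (Dom X i \<inter> Dom X j) (l i j)" by (simp add: lpow_def)
  assume x: "x \<in> Dom X i \<inter> Dom X j"
  have "lpow l 1 i j x * lpow l 1 j i x = lpow l 1 i i x"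
    using l assms x unfolding holo_bundle_def by blast
  also have "\<dots> = 1\<^sub>m 1"
    using l assms x unfolding holo_bundle_def by blast
  finally have "scalar (l i j x * l j i x) = 1\<^sub>m 1" by (simp add: lpow_def scalar_mult)
  then have "scalar (l i j x * l j i x) $$ (0, 0) = 1\<^sub>m 1 $$ (0, 0)" by simp
  then show "l i j x \<noteq> 0" by auto
qed

lemma sum_lessThan_eq_triangular: "2 * (\<Sum>q<n. q) = n * (n - 1)" for n :: nat
  by (induction n) (auto simp: algebra_simps)

text \<open>
  The transition matrices of the jet bundle of \<open>V\<close> are triangular, with the transition functions
  of \<open>V \<otimes> K\<^sup>q\<close>, \<open>q < n\<close>, on the diagonal. For \<open>V = L\<^bsup>1-n\<^esup>\<close> and \<open>K = L\<^sup>2\<close> the powers of \<open>L\<close> cancel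
  in the determinant, and what remains is the coboundary of a power of \<open>\<theta>\<close>.
\<close>

lemma det_jet_bundle_theta_char:
  assumes theta: "theta_char X l \<theta>" and n: "n > 0"
    and ij: "i \<in> Idx X" "j \<in> Idx X" and x: "x \<in> Dom X i \<inter> Dom X j"
  shows "Determinant.det (jet_bundle X (n - 1) 1 (lpow l (1 - int n)) i j x)
    = (\<theta> i x / \<theta> j x) ^ (\<Sum>q<n. q)"
proof -
  have xi: "x \<in> Dom X i" and xj: "x \<in> Dom X j" using x by auto
  define c where "c = l i j x"
  define F where "F = taylor X i x (\<lambda>y. l i j y powi (1 - int n))"
  define H where "H = taylor X i x (\<lambda>y. crd X j y - crd X j x)"
  define M where "M = jet_bundle X (n - 1) 1 (lpow l (1 - int n)) i j x"
  have c: "c \<noteq> 0" using theta_char_cocycle(2)[OF theta ij x] by (simp add: c_def)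
  have "holo_at X i x (l i j)"
    using theta_char_cocycle(1)[OF theta ij] chart(1) ij x
    by (intro holo_on_imp_holo_at[of _ _ "Dom X i \<inter> Dom X j"]) auto
  then have F_holo: "holo_at X i x (\<lambda>y. l i j y powi (1 - int n))"
    using c cinv_crd[OF ij(1) xi] unfolding holo_at_def o_def c_def by (intro analytic_intros) auto
  have entry: "M $$ (p, q) = fps_nth (F * H ^ q) p" if "p < n" "q < n" for p q
    using that taylor_mult(1)[OF F_holo taylor_power(2)[OF taylor_other_crd(1)[OF ij xi xj]]]
      taylor_power(1)[OF taylor_other_crd(1)[OF ij xi xj]]
    by (simp add: M_def jet_bundle_def tcoeff_eq_taylor lpow_def F_def H_def)
  have M: "M \<in> carrier_mat n n" using n by (simp add: M_def jet_bundle_def)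
  have H: "fps_nth H 0 = 0" "fps_nth H 1 = canon X i j x"
    using taylor_other_crd[OF ij xi xj] by (simp_all add: H_def)
  have "Determinant.det M = prod_list (diag_mat M)"
    using M H(1) entry by (intro det_lower_triangular[of n]) (auto simp: fps_mult_power_nth)
  also have "\<dots> = (\<Prod>q<n. M $$ (q, q))"
    using M by (simp add: diag_mat_def prod.list_conv_set_nth atLeast0LessThan)
  also have "\<dots> = (\<Prod>q<n. c powi (1 - int n) * canon X i j x ^ q)"
    using entry H taylor_nth_0[OF ij(1) xi] by (intro prod.cong) (auto simp: fps_mult_power_nth F_def c_def)
  also have "\<dots> = (c powi (1 - int n)) ^ n * canon X i j x ^ (\<Sum>q<n. q)"
    by (simp add: prod.distrib power_sum)
  also have "c powi (1 - int n) = inverse (c ^ (n - 1))"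
  proof -
    have "1 - int n = - int (n - 1)" using n by simp
    then show ?thesis by (simp only: power_int_minus power_int_of_nat)
  qed
  also have "inverse (c ^ (n - 1)) ^ n = inverse (c ^ (2 * (\<Sum>q<n. q)))"
    unfolding sum_lessThan_eq_triangular by (simp add: power_inverse power_mult[symmetric] mult.commute)
  also have "canon X i j x = \<theta> i x / \<theta> j x * c\<^sup>2"
    using theta_char_transition[OF theta ij x] theta_char_nonzero[OF theta ij(2) xj]
    by (simp add: c_def field_simps)
  also have "inverse (c ^ (2 * (\<Sum>q<n. q))) * (\<theta> i x / \<theta> j x * c\<^sup>2) ^ (\<Sum>q<n. q)
      = (\<theta> i x / \<theta> j x) ^ (\<Sum>q<n. q)"
    using c unfolding power_mult power_mult_distrib by simp
  finally show ?thesis by (simp add: M_def)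
qed

section \<open>Second order behaviour of the kernels along the diagonal\<close>

lemma eventually_punctured_chart:
  assumes "i \<in> Idx X" "x \<in> Dom X i"
  shows "\<forall>\<^sub>F y in at x. y \<in> Dom X i \<and> y \<noteq> x \<and> crd X i y - crd X i x \<noteq> 0"
  unfolding eventually_at_filter
  by (rule eventually_mono[OF eventually_nhds_in_open[OF chart(1)[OF assms(1)] assms(2)]])
    (use assms crd_eq_iff in auto)

text \<open>
  The kernel of the de Rham operator has no residue along the diagonal, as constants have
  derivative \<open>0\<close>. Therefore \<open>\<delta>\<close>, which is a square root of it, is
  \<open>(\<theta>(x) \<theta>(y))\<^bsup>-1/2\<^esup> (y - x)\<^sup>-\<^sup>1\<close> up to terms vanishing on the diagonal.
\<close>

lemma delta_expansion:
  assumes theta: "theta_char X l \<theta>" and delta: "is_delta X l \<theta> \<delta>"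
    and ix: "i \<in> Idx X" "x \<in> Dom X i"
  obtains d where "holo_at X i x d"
    "\<forall>\<^sub>F y in at x. (crd X i y - crd X i x) * \<delta> i x y = d y"
    "\<theta> i x * d x = 1"
    "2 * \<theta> i x * fps_nth (taylor X i x d) 1 + fps_nth (taylor X i x (\<theta> i)) 1 * d x = 0"
proof -
  have "diag_order X i 1 (Dom X i) (\<lambda>x y. scalar (\<delta> i x y) $$ (0, 0))"
    using delta ix unfolding is_delta_def kernel_section_on_kDelta_def by blast
  then have "diag_order X i 1 (Dom X i) (\<delta> i)" by simp
  then obtain d where d: "holo_at X i x d" "\<forall>\<^sub>F y in at x. (crd X i y - crd X i x) powi 1 * \<delta> i x y = d y"
    using diag_order_slice[OF ix] by metis
  have d1: "\<forall>\<^sub>F y in at x. (crd X i y - crd X i x) * \<delta> i x y = d y"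
    using d(2) by simp
  have th: "holo_at X i x (\<theta> i)"
    using holo_on_imp_holo_at[OF ix(1) ix(2,2) chart(1)[OF ix(1)] theta_char_holo[OF theta ix(1)]] .
  have nz: "\<theta> i x \<noteq> 0" using theta_char_nonzero[OF theta ix] .
  have "diag_value X i 1 (\<lambda>x y. \<theta> i x * \<delta> i x y) x 1"
    using delta ix unfolding is_delta_def by blast
  from diag_value_unique[OF ix this taylor_mult(2)[OF taylor_const(2) d(1)], of "\<theta> i x"]
  have diag: "\<theta> i x * d x = 1"
    using d1 by (force elim: eventually_mono)
  define h where "h = (\<lambda>y. \<theta> i x * (\<theta> i y * d y ^ 2))"
  have h: "holo_at X i x h"
    unfolding h_def by (intro taylor_mult(2) taylor_const(2) th taylor_power(2) d(1))
  have taylor_h: "taylor X i x h = fps_const (\<theta> i x) * (taylor X i x (\<theta> i) * taylor X i x d ^ 2)"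
    unfolding h_def using th d(1) by (simp add: taylor_mult taylor_const taylor_power)
  have "\<forall>\<^sub>F y in at x. (crd X i y - crd X i x) ^ Suc 1 * (\<theta> i x * \<theta> i y * (\<delta> i x y)\<^sup>2 * 1) = h y"
    using d1
  proof eventually_elim
    case (elim y)
    show ?case unfolding h_def elim[symmetric] by (simp add: power2_eq_square mult_ac)
  qed
  from residue_pairing_taylor[OF ix h, where f = "\<lambda>_. 1" and k = 1
      and \<kappa> = "\<lambda>x y. \<theta> i x * \<theta> i y * (\<delta> i x y)\<^sup>2", OF this]
  have "fps_nth (taylor X i x h) 1 = residue_pairing X i (\<lambda>x y. \<theta> i x * \<theta> i y * (\<delta> i x y)\<^sup>2) (\<lambda>_. 1) x"
    by simp
  also have "\<dots> = tcoeff X i x 1 (\<lambda>_. 1)"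
  proof -
    have "\<forall>S f. open S \<and> S \<subseteq> Dom X i \<and> holo_on X S f \<longrightarrow> (\<forall>x\<in>S.
        residue_pairing X i (\<lambda>x y. \<theta> i x * \<theta> i y * (\<delta> i x y)\<^sup>2) f x = tcoeff X i x 1 f)"
      using delta ix unfolding is_delta_def is_deRham_kernel_def by blast
    then show ?thesis
      using chart(1)[OF ix(1)] ix(2) holo_on_const by blast
  qed
  also have "\<dots> = 0" by (simp add: tcoeff_eq_taylor taylor_const)
  finally have "\<theta> i x * (d x * (2 * \<theta> i x * fps_nth (taylor X i x d) 1
      + fps_nth (taylor X i x (\<theta> i)) 1 * d x)) = 0"
    by (simp add: taylor_h power2_eq_square fps_mult_nth_1 taylor_nth_0[OF ix] algebra_simps)
  moreover have "d x \<noteq> 0" using diag by auto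
  ultimately show ?thesis using that[OF d(1) d1 diag] nz by simp
qed

text \<open>With \<open>N = -1\<close>, the diagonal value of a difference is the limit of difference quotients.\<close>

lemma tcoeff_eq_diag_value:
  assumes ix: "i \<in> Idx X" "x \<in> Dom X i" and f: "holo_at X i x f"
    and eq: "\<forall>\<^sub>F y in at x. \<kappa> x y = f y - f x"
    and v: "diag_value X i (- 1) \<kappa> x c"
  shows "fps_nth (taylor X i x f) 1 = c"
proof -
  let ?F = "f \<circ> cinv X i" and ?z = "crd X i x"
  have "((\<lambda>w. (crd X i (cinv X i w) - crd X i x) powi (- 1) * \<kappa> x (cinv X i w)) \<longlongrightarrow> c) (at ?z)"
    using v tendsto_cinv_punctured[OF ix] unfolding diag_value_def by (rule filterlim_compose)
  moreover have "\<forall>\<^sub>F w in at ?z. w \<in> crd X i ` Dom X i"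
    using eventually_crd_image[OF ix] by (simp add: eventually_at_filter eventually_mono)
  then have "\<forall>\<^sub>F w in at ?z. (crd X i (cinv X i w) - crd X i x) powi (- 1) * \<kappa> x (cinv X i w)
      = (?F w - ?F ?z) / (w - ?z)"
    using eventually_cinv(2)[OF ix eq]
    by eventually_elim (use crd_cinv[OF ix(1)] cinv_crd[OF ix] in \<open>simp add: power_int_minus divide_inverse\<close>)
  ultimately have "((\<lambda>w. (?F w - ?F ?z) / (w - ?z)) \<longlongrightarrow> c) (at ?z)"
    by (rule Lim_transform_eventually)
  then have "(?F has_field_derivative c) (at ?z)"
    by (simp add: has_field_derivative_iff)
  then show ?thesis
    by (simp add: taylor_def fps_expansion_def DERIV_imp_deriv)
qed

lemma connectionD:
  assumes "connection X m G D" "i \<in> Idx X" "x \<in> Dom X i"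
  shows "D i x \<in> carrier_mat m (2 * m)" and "D i x * jet_incl 1 m = 1\<^sub>m m"
  using assms(1)[unfolded connection_def bundle_hom_def, THEN conjunct1, THEN conjunct1]
    assms(1)[unfolded connection_def, THEN conjunct2] assms(2,3) by blast+

text \<open>
  To first order in \<open>y - x\<close>, \<open>\<Phi>\<close> is \<open>1 + \<Gamma> (y - x)\<close> where \<open>\<Gamma>\<close> is the connection matrix of \<open>D\<^sup>E\<close>,
  and \<open>A\<close> is the product of \<open>\<Phi>\<close> and \<open>\<delta>\<close>.
\<close>

lemma A_expansion:
  assumes theta: "theta_char X l \<theta>"
    and A: "is_A X l \<theta> r E A" and Phi: "is_Phi X r E A \<delta> \<Phi>" and DE: "is_DE X r E \<Phi> DE"
    and ix: "i \<in> Idx X" "x \<in> Dom X i" and ab: "a < r" "b < r"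
    and d: "holo_at X i x d" "\<forall>\<^sub>F y in at x. (crd X i y - crd X i x) * \<delta> i x y = d y"
      "\<theta> i x * d x = 1"
  obtains g where "holo_at X i x g"
    "\<forall>\<^sub>F y in at x. (crd X i y - crd X i x) * A i i x y $$ (a, b) = g y"
    "g x = (if a = b then d x else 0)"
    "fps_nth (taylor X i x g) 1 =
      d x * DE i x $$ (a, b) + (if a = b then fps_nth (taylor X i x d) 1 else 0)"
proof -
  have "\<forall>i\<in>Idx X. \<forall>a<r. \<forall>b<r. diag_order X i 1 (Dom X i) (\<lambda>x y. A i i x y $$ (a, b))"
    using A unfolding is_A_def kernel_section_def by (elim conjE)
  then have A_order: "diag_order X i 1 (Dom X i) (\<lambda>x y. A i i x y $$ (a, b))"
    using ix ab by simp
  obtain g where g: "holo_at X i x g"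
    "\<forall>\<^sub>F y in at x. (crd X i y - crd X i x) powi 1 * A i i x y $$ (a, b) = g y"
    by (rule diag_order_slice[OF ix A_order]) (rule that)
  have "\<forall>i\<in>Idx X. \<forall>a<r. \<forall>b<r. diag_order X i 0 (Dom X i) (\<lambda>x y. \<Phi> i x y $$ (a, b))"
    using Phi unfolding is_Phi_def kernel_section_on_kDelta_def by (elim conjE)
  then have \<Phi>_order: "diag_order X i 0 (Dom X i) (\<lambda>x y. \<Phi> i x y $$ (a, b))"
    using ix ab by simp
  obtain \<phi> where \<phi>: "holo_at X i x \<phi>"
    "\<forall>\<^sub>F y in at x. (crd X i y - crd X i x) powi 0 * \<Phi> i x y $$ (a, b) = \<phi> y"
    by (rule diag_order_slice[OF ix \<Phi>_order]) (rule that)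
  have diff_order: "diag_order X i (1 - int 2) (Dom X i)
      (\<lambda>x y. A i i x y $$ (a, b) - (\<delta> i x y \<cdot>\<^sub>m \<Phi> i x y) $$ (a, b))"
    using Phi[unfolded is_Phi_def eq_mod_kDelta_def, THEN conjunct2] ix(1) ab by simp
  obtain e where e: "holo_at X i x e"
    "\<forall>\<^sub>F y in at x. (crd X i y - crd X i x) powi (1 - int 2) *
      (A i i x y $$ (a, b) - (\<delta> i x y \<cdot>\<^sub>m \<Phi> i x y) $$ (a, b)) = e y"
    by (rule diag_order_slice[OF ix diff_order]) (rule that)
  have \<Phi>_carrier: "\<Phi> i x y \<in> carrier_mat r r" if "y \<in> Dom X i" for y
    using Phi[unfolded is_Phi_def kernel_section_on_kDelta_def, THEN conjunct1, THEN conjunct1] ix that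
    by simp

  \<comment> \<open>The condition modulo \<open>2\<Delta>\<close>, multiplied by \<open>y - x\<close>.\<close>
  have "\<forall>\<^sub>F y in at x. g y = d y * \<phi> y + (crd X i y - crd X i x) ^ 2 * e y"
    using g(2) \<phi>(2) e(2) d(2) eventually_punctured_chart[OF ix]
  proof eventually_elim
    case (elim y)
    let ?z = "crd X i y - crd X i x"
    have nz: "?z \<noteq> 0" using elim by simp
    have "e y = inverse ?z * (A i i x y $$ (a, b) - \<delta> i x y * \<phi> y)"
      using elim \<Phi>_carrier[of y] ab by (auto simp: power_int_minus)
    then have "?z * e y = A i i x y $$ (a, b) - \<delta> i x y * \<phi> y"
      by (simp only: mult.assoc[symmetric] right_inverse[OF nz] mult_1_left)
    then have "?z * (?z * e y) = ?z * (A i i x y $$ (a, b) - \<delta> i x y * \<phi> y)" by simp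
    then show ?case using elim(1,4) by (simp add: power2_eq_square algebra_simps)
  qed
  moreover have "holo_at X i x (\<lambda>y. d y * \<phi> y + (crd X i y - crd X i x) ^ 2 * e y)"
    by (intro taylor_add(2) taylor_mult(2) taylor_power(2) taylor_crd(2) ix d(1) \<phi>(1) e(1))
  ultimately have "taylor X i x g = taylor X i x (\<lambda>y. d y * \<phi> y + (crd X i y - crd X i x) ^ 2 * e y)"
    by (intro taylor_eq_if_eq_punctured[OF ix g(1)])
  also have "\<dots> = taylor X i x d * taylor X i x \<phi> + fps_X ^ 2 * taylor X i x e"
    using d(1) \<phi>(1) e(1) taylor_crd[OF ix] by (simp add: taylor_add taylor_mult taylor_power)
  finally have taylor_g: "taylor X i x g = taylor X i x d * taylor X i x \<phi> + fps_X ^ 2 * taylor X i x e" .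
  have g0: "g x = d x * \<phi> x"
    using arg_cong[OF taylor_g, of "\<lambda>F. fps_nth F 0"] by (simp add: taylor_nth_0[OF ix] fps_X_power_mult_nth)
  have g1: "fps_nth (taylor X i x g) 1
      = d x * fps_nth (taylor X i x \<phi>) 1 + fps_nth (taylor X i x d) 1 * \<phi> x"
    using arg_cong[OF taylor_g, of "\<lambda>F. fps_nth F 1"]
    by (simp add: taylor_nth_0[OF ix] fps_X_power_mult_nth fps_mult_nth_1)

  have A_diag: "diag_value X i 1 (\<lambda>x y. \<theta> i x * A i i x y $$ (a, b)) x (if a = b then 1 else 0)"
    using A[unfolded is_A_def, THEN conjunct2] ix ab by simp
  have "\<forall>\<^sub>F y in at x. (crd X i y - crd X i x) powi 1 * (\<theta> i x * A i i x y $$ (a, b)) = \<theta> i x * g y"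
    using g(2)
  proof eventually_elim
    case (elim y)
    show ?case unfolding elim[symmetric] by (simp only: mult_ac)
  qed
  from diag_value_unique[OF ix A_diag taylor_mult(2)[OF taylor_const(2) g(1)] this]
  have "\<theta> i x * g x = (if a = b then 1 else 0)" .
  then have \<phi>x: "\<phi> x = (if a = b then 1 else 0)"
    using d(3) g0 by (metis mult.assoc mult.left_neutral)

  have conn: "DE i x \<in> carrier_mat r (2 * r)" "DE i x * jet_incl 1 r = 1\<^sub>m r"
    using connectionD[OF DE[unfolded is_DE_def, THEN conjunct1] ix] .
  let ?s = "\<lambda>_. unit_vec r b"
  have "local_section X i r (Dom X i) ?s"
    using chart(1)[OF ix(1)] holo_on_const by (simp add: local_section_def)
  then have "diag_value X i (- 1) (\<lambda>x y. vec_index (\<Phi> i x y *\<^sub>v unit_vec r b) a - vec_index (unit_vec r b) a) x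
      (vec_index (DE i x *\<^sub>v jet X i 1 r ?s x) a)"
    using DE[unfolded is_DE_def, THEN conjunct2, THEN bspec[OF _ ix(1)]] ix(2) ab(1) by simp
  moreover have "vec_index (DE i x *\<^sub>v jet X i 1 r ?s x) a = DE i x $$ (a, b)"
  proof -
    have "(\<Sum>c<r. DE i x $$ (a, c) * vec_index (unit_vec r b) c) = (\<Sum>c<r. if c = b then DE i x $$ (a, c) else 0)"
      by (intro sum.cong) (auto simp: unit_vec_def)
    then show ?thesis
      unfolding connection_apply[OF ix conn(1) ab(1) conn(2)] using ab(2)
      by (simp add: tcoeff_eq_taylor taylor_const)
  qed
  moreover have "\<forall>\<^sub>F y in at x.
      vec_index (\<Phi> i x y *\<^sub>v unit_vec r b) a - vec_index (unit_vec r b) a = \<phi> y - \<phi> x"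
    using \<phi>(2) eventually_punctured_chart[OF ix]
  proof eventually_elim
    case (elim y)
    have "vec_index (\<Phi> i x y *\<^sub>v unit_vec r b) a = \<phi> y"
      unfolding mult_unit_vec_index[OF \<Phi>_carrier[OF elim(2)[THEN conjunct1]] ab] elim(1)[symmetric] by simp
    moreover have "vec_index (unit_vec r b) a = \<phi> x"
      using ab by (simp add: \<phi>x unit_vec_def)
    ultimately show ?case by (simp only:)
  qed
  ultimately have "fps_nth (taylor X i x \<phi>) 1 = DE i x $$ (a, b)"
    by (intro tcoeff_eq_diag_value[OF ix \<phi>(1)]) auto
  with g(2) g0 g1 \<phi>x show ?thesis
    by (intro that[OF g(1)]) auto
qed

text \<open>
  Being parallel in the second variable and the identity on the diagonal, \<open>f\<close> is
  \<open>1 - \<Gamma> (y - x)\<close> to first order.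
\<close>

lemma parallel_iso_expansion:
  assumes U: "tubular_nbhd U" and par: "is_parallel_iso X r E DE U f" and conn: "connection X r E DE"
    and ix: "i \<in> Idx X" "x \<in> Dom X i" and ab: "a < r" "b < r"
  shows "holo_at X i x (\<lambda>y. f i i x y $$ (a, b))"
    and "\<forall>\<^sub>F y in at x. f i i x y \<in> carrier_mat r r"
    and "f i i x x $$ (a, b) = (if a = b then 1 else 0)"
    and "fps_nth (taylor X i x (\<lambda>y. f i i x y $$ (a, b))) 1 = - DE i x $$ (a, b)"
proof -
  define W where "W = U \<inter> (Dom X i \<times> Dom X i)"
  have W: "open W" "(x, x) \<in> W"
    using U ix chart(1)[OF ix(1)] by (auto simp: W_def tubular_nbhd_def intro: open_Times)
  have f_carrier: "f i i x y \<in> carrier_mat r r" if "(x, y) \<in> W" for y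
    using par[unfolded is_parallel_iso_def, THEN conjunct1, THEN bspec[OF _ ix(1)],
        THEN bspec[OF _ ix(1)]] that unfolding W_def by blast
  have f_id: "f i i x x = 1\<^sub>m r"
    using par[unfolded is_parallel_iso_def, THEN conjunct2, THEN conjunct2, THEN conjunct2,
        THEN conjunct1] ix by simp
  then show "f i i x x $$ (a, b) = (if a = b then 1 else 0)" using ab by simp
  have "holo2_on X W (\<lambda>(x, y). f i i x y $$ (a, b))"
    using par[unfolded is_parallel_iso_def, THEN conjunct2, THEN conjunct1] ix(1) ab
    unfolding W_def by simp
  from holo2_slice[OF ix(1,1,2,2) W(2,1) this]
  show "holo_at X i x (\<lambda>y. f i i x y $$ (a, b))" by simp
  have "open {y. (x, y) \<in> W}"
    using open_vimage[OF W(1), of "Pair x"] by (simp add: vimage_def continuous_intros)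
  then have ev: "\<forall>\<^sub>F y in nhds x. (x, y) \<in> W"
    using eventually_nhds_in_open[of "{y. (x, y) \<in> W}" x] W(2) by simp
  then show "\<forall>\<^sub>F y in at x. f i i x y \<in> carrier_mat r r"
    unfolding eventually_at_filter by (rule eventually_mono) (use f_carrier in blast)

  have DE: "DE i x \<in> carrier_mat r (2 * r)" "DE i x * jet_incl 1 r = 1\<^sub>m r"
    using connectionD[OF conn ix] .
  let ?s = "\<lambda>_::'a \<times> 'a. unit_vec r b :: complex Matrix.vec"
  have "\<forall>p\<in>W. ?s p \<in> carrier_vec r" by simp
  moreover have "\<forall>a<r. holo2_on X W (\<lambda>p. vec_index (?s p) a)"
    unfolding holo2_on_def
  proof (intro allI ballI impI)
    fix a and i' j' :: 'i and y z :: 'a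
    show "\<exists>u v. ((\<lambda>(z, w). vec_index (unit_vec r b) a) has_derivative (\<lambda>(h, k). u * h + v * k))
        (at (crd X i' y, crd X j' z))"
      by (intro exI[of _ 0]) (simp add: case_prod_unfold)
  qed
  moreover have "W \<subseteq> U \<inter> (Dom X i \<times> Dom X i)" by (simp add: W_def)
  ultimately have admissible: "open W \<and> W \<subseteq> U \<inter> (Dom X i \<times> Dom X i) \<and> (\<forall>p\<in>W. ?s p \<in> carrier_vec r) \<and>
      (\<forall>a<r. holo2_on X W (\<lambda>p. vec_index (?s p) a))"
    using W(1) by blast
  note parallel = par[unfolded is_parallel_iso_def, THEN conjunct2, THEN conjunct2, THEN conjunct2,
      THEN conjunct2, THEN bspec[OF _ ix(1)], THEN bspec[OF _ ix(1)], THEN spec[of _ W],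
      THEN spec[of _ ?s], THEN mp, OF admissible, THEN bspec[OF _ W(2)]]
  have "f i i x x *\<^sub>v vderiv X i r (\<lambda>y'. ?s (x, y')) x
      = DE i x *\<^sub>v jet X i 1 r (\<lambda>y'. f i i x y' *\<^sub>v ?s (x, y')) x"
    using parallel unfolding prod.case by (elim conjE)
  moreover have "vderiv X i r (\<lambda>y'. ?s (x, y')) x = 0\<^sub>v r"
    by (auto simp: vderiv_def tcoeff_eq_taylor taylor_const)
  ultimately have "DE i x *\<^sub>v jet X i 1 r (\<lambda>y'. f i i x y' *\<^sub>v unit_vec r b) x = 0\<^sub>v r"
    by (simp only: f_id one_mult_mat_vec zero_carrier_vec)
  then have "0 = vec_index (DE i x *\<^sub>v jet X i 1 r (\<lambda>y'. f i i x y' *\<^sub>v unit_vec r b) x) a"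
    using ab by (simp only: index_zero_vec)
  also have "\<dots> = (\<Sum>c<r. DE i x $$ (a, c) * vec_index (f i i x x *\<^sub>v unit_vec r b) c)
      + tcoeff X i x 1 (\<lambda>y. vec_index (f i i x y *\<^sub>v unit_vec r b) a)"
    by (rule connection_apply[OF ix DE(1) ab(1) DE(2)])
  also have "(\<Sum>c<r. DE i x $$ (a, c) * vec_index (f i i x x *\<^sub>v unit_vec r b) c)
      = (\<Sum>c<r. if c = b then DE i x $$ (a, c) else 0)"
    unfolding f_id by (intro sum.cong) (auto simp: unit_vec_def)
  also have "\<dots> = DE i x $$ (a, b)" using ab by simp
  also have "tcoeff X i x 1 (\<lambda>y. vec_index (f i i x y *\<^sub>v unit_vec r b) a)
      = fps_nth (taylor X i x (\<lambda>y. f i i x y $$ (a, b))) 1"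
    unfolding tcoeff_eq_taylor
  proof (intro arg_cong2[of _ _ _ _ fps_nth] taylor_cong[OF ix] eventually_mono[OF ev] refl)
    fix y assume y: "(x, y) \<in> W"
    then show "vec_index (f i i x y *\<^sub>v unit_vec r b) a = f i i x y $$ (a, b)"
      by (intro mult_unit_vec_index[OF f_carrier] ab)
  qed
  finally show "fps_nth (taylor X i x (\<lambda>y. f i i x y $$ (a, b))) 1 = - DE i x $$ (a, b)"
    by (simp add: eq_neg_iff_add_eq_0 add.commute)
qed

text \<open>
  The connection matrix cancels in \<open>A f = \<delta> (1 + \<Gamma> (y - x)) (1 - \<Gamma> (y - x))\<close>, so that the normalised
  trace agrees with \<open>\<delta>\<close> over \<open>2\<Delta>\<close>.
\<close>

lemma beta_hat_expansion:
  assumes theta: "theta_char X l \<theta>" and r: "r \<ge> 1"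
    and A: "is_A X l \<theta> r E A" and Phi: "is_Phi X r E A \<delta> \<Phi>" and DE: "is_DE X r E \<Phi> DE"
    and U: "tubular_nbhd U" and par: "is_parallel_iso X r E DE U f"
    and ix: "i \<in> Idx X" "x \<in> Dom X i"
    and d: "holo_at X i x d" "\<forall>\<^sub>F y in at x. (crd X i y - crd X i x) * \<delta> i x y = d y"
      "\<theta> i x * d x = 1"
  obtains \<beta> where "holo_at X i x \<beta>"
    "\<forall>\<^sub>F y in at x. (crd X i y - crd X i x) * beta_hat r A f i i x y = \<beta> y"
    "\<beta> x = d x" "fps_nth (taylor X i x \<beta>) 1 = fps_nth (taylor X i x d) 1"
proof -
  have "\<exists>g. holo_at X i x g \<and>
      (\<forall>\<^sub>F y in at x. (crd X i y - crd X i x) * A i i x y $$ (a, b) = g y) \<and>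
      g x = (if a = b then d x else 0) \<and>
      fps_nth (taylor X i x g) 1 =
        d x * DE i x $$ (a, b) + (if a = b then fps_nth (taylor X i x d) 1 else 0)"
    if "a < r" "b < r" for a b
    by (rule A_expansion[OF theta A Phi DE ix that d]) blast
  then have "\<forall>p. \<exists>g. fst p < r \<longrightarrow> snd p < r \<longrightarrow> holo_at X i x g \<and>
      (\<forall>\<^sub>F y in at x. (crd X i y - crd X i x) * A i i x y $$ (fst p, snd p) = g y) \<and>
      g x = (if fst p = snd p then d x else 0) \<and>
      fps_nth (taylor X i x g) 1 =
        d x * DE i x $$ (fst p, snd p) + (if fst p = snd p then fps_nth (taylor X i x d) 1 else 0)"
    by blast
  from choice[OF this] obtain g' where g': "\<And>a b. a < r \<Longrightarrow> b < r \<Longrightarrow> holo_at X i x (g' (a, b)) \<and>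
      (\<forall>\<^sub>F y in at x. (crd X i y - crd X i x) * A i i x y $$ (a, b) = g' (a, b) y) \<and>
      g' (a, b) x = (if a = b then d x else 0) \<and>
      fps_nth (taylor X i x (g' (a, b))) 1 =
        d x * DE i x $$ (a, b) + (if a = b then fps_nth (taylor X i x d) 1 else 0)"
    by auto
  define g where "g = (\<lambda>a b. g' (a, b))"
  have g: "\<And>a b. a < r \<Longrightarrow> b < r \<Longrightarrow> holo_at X i x (g a b)"
    "\<And>a b. a < r \<Longrightarrow> b < r \<Longrightarrow>
      \<forall>\<^sub>F y in at x. (crd X i y - crd X i x) * A i i x y $$ (a, b) = g a b y"
    "\<And>a b. a < r \<Longrightarrow> b < r \<Longrightarrow> g a b x = (if a = b then d x else 0)"
    "\<And>a b. a < r \<Longrightarrow> b < r \<Longrightarrow> fps_nth (taylor X i x (g a b)) 1 =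
      d x * DE i x $$ (a, b) + (if a = b then fps_nth (taylor X i x d) 1 else 0)"
    unfolding g_def using g' by blast+
  have conn: "connection X r E DE" using DE by (simp add: is_DE_def)
  note f = parallel_iso_expansion[OF U par conn ix]
  define \<beta> where "\<beta> = (\<lambda>y. 1 / of_nat r * (\<Sum>a<r. \<Sum>c<r. g a c y * f i i x y $$ (c, a)))"
  have holo: "holo_at X i x (\<lambda>y. \<Sum>c<r. g a c y * f i i x y $$ (c, a))"
    and taylor: "taylor X i x (\<lambda>y. \<Sum>c<r. g a c y * f i i x y $$ (c, a))
      = (\<Sum>c<r. taylor X i x (g a c) * taylor X i x (\<lambda>y. f i i x y $$ (c, a)))" if "a < r" for a
  proof -
    have holo_mult: "holo_at X i x (\<lambda>y. g a c y * f i i x y $$ (c, a))" if "c \<in> {..<r}" for c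
      using g(1)[OF \<open>a < r\<close>] f(1)[OF _ \<open>a < r\<close>] that by (intro taylor_mult(2)) auto
    show "holo_at X i x (\<lambda>y. \<Sum>c<r. g a c y * f i i x y $$ (c, a))"
      by (rule taylor_sum(2)[OF holo_mult])
    show "taylor X i x (\<lambda>y. \<Sum>c<r. g a c y * f i i x y $$ (c, a))
      = (\<Sum>c<r. taylor X i x (g a c) * taylor X i x (\<lambda>y. f i i x y $$ (c, a)))"
    proof (rule trans[OF taylor_sum(1)[OF holo_mult]], assumption, intro sum.cong taylor_mult(1) refl)
      fix c assume "c \<in> {..<r}"
      then have "c < r" by simp
      then show "holo_at X i x (g a c)" "holo_at X i x (\<lambda>y. f i i x y $$ (c, a))"
        using g(1)[OF \<open>a < r\<close>] f(1)[OF _ \<open>a < r\<close>] by blast+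
    qed
  qed
  have holo': "holo_at X i x (\<lambda>y. \<Sum>c<r. g a c y * f i i x y $$ (c, a))" if "a \<in> {..<r}" for a
    using that by (intro holo) simp
  have \<beta>_holo: "holo_at X i x \<beta>"
    unfolding \<beta>_def by (rule taylor_mult(2)[OF taylor_const(2) taylor_sum(2)[OF holo']])
  have taylor_\<beta>: "taylor X i x \<beta> = fps_const (1 / of_nat r) *
      (\<Sum>a<r. \<Sum>c<r. taylor X i x (g a c) * taylor X i x (\<lambda>y. f i i x y $$ (c, a)))"
  proof -
    have "taylor X i x (\<lambda>y. \<Sum>a<r. \<Sum>c<r. g a c y * f i i x y $$ (c, a))
        = (\<Sum>a<r. taylor X i x (\<lambda>y. \<Sum>c<r. g a c y * f i i x y $$ (c, a)))"
      by (rule taylor_sum(1)[OF holo'])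
    also have "\<dots> = (\<Sum>a<r. \<Sum>c<r. taylor X i x (g a c) * taylor X i x (\<lambda>y. f i i x y $$ (c, a)))"
      using taylor by (intro sum.cong) auto
    finally have sum: "taylor X i x (\<lambda>y. \<Sum>a<r. \<Sum>c<r. g a c y * f i i x y $$ (c, a))
        = (\<Sum>a<r. \<Sum>c<r. taylor X i x (g a c) * taylor X i x (\<lambda>y. f i i x y $$ (c, a)))" .
    have "taylor X i x \<beta> = taylor X i x (\<lambda>_. 1 / of_nat r)
        * taylor X i x (\<lambda>y. \<Sum>a<r. \<Sum>c<r. g a c y * f i i x y $$ (c, a))"
      unfolding \<beta>_def by (rule taylor_mult(1)[OF taylor_const(2) taylor_sum(2)[OF holo']])
    then show ?thesis by (simp only: taylor_const(1) sum)
  qed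
  have A_carrier: "A i i x y \<in> carrier_mat r r" if "y \<in> Dom X i" for y
    using A[unfolded is_A_def kernel_section_def, THEN conjunct1, THEN conjunct1] ix that by simp
  have "\<forall>\<^sub>F y in at x. \<forall>a\<in>{..<r}. \<forall>b\<in>{..<r}. (crd X i y - crd X i x) * A i i x y $$ (a, b) = g a b y"
    by (intro eventually_ball_finite ballI finite_lessThan) (use g(2) in auto)
  moreover have "\<forall>\<^sub>F y in at x. f i i x y \<in> carrier_mat r r"
    using f(2)[of 0 0] r by simp
  ultimately have "\<forall>\<^sub>F y in at x. (crd X i y - crd X i x) * beta_hat r A f i i x y = \<beta> y"
    using eventually_punctured_chart[OF ix]
  proof eventually_elim
    case (elim y)
    let ?z = "crd X i y - crd X i x"
    have "?z * (A i i x y * f i i x y) $$ (a, a) = (\<Sum>c<r. g a c y * f i i x y $$ (c, a))" if a: "a < r" for a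
    proof -
      have "?z * (A i i x y * f i i x y) $$ (a, a)
          = (\<Sum>c<r. (?z * A i i x y $$ (a, c)) * f i i x y $$ (c, a))"
        unfolding index_mult_mat_sum[OF A_carrier[OF elim(3)[THEN conjunct1]] elim(2) a a] sum_distrib_left
        by (simp only: mult.assoc)
      also have "\<dots> = (\<Sum>c<r. g a c y * f i i x y $$ (c, a))"
        using elim(1) a by (intro sum.cong) auto
      finally show ?thesis .
    qed
    then have "?z * (\<Sum>a<r. (A i i x y * f i i x y) $$ (a, a))
        = (\<Sum>a<r. \<Sum>c<r. g a c y * f i i x y $$ (c, a))"
      unfolding sum_distrib_left by (intro sum.cong) auto
    then show ?case
      unfolding beta_hat_def \<beta>_def mult.left_commute[of ?z] by (rule arg_cong)
  qed
  moreover have "\<beta> x = d x"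
  proof -
    have "(\<Sum>a<r. \<Sum>c<r. g a c x * f i i x x $$ (c, a)) = (\<Sum>a<r. \<Sum>c<r. if c = a then d x else 0)"
      using g(3) f(3) by (intro sum.cong) auto
    then show ?thesis using r by (simp add: \<beta>_def)
  qed
  moreover have "fps_nth (taylor X i x \<beta>) 1 = fps_nth (taylor X i x d) 1"
  proof -
    have "(\<Sum>a<r. \<Sum>c<r. fps_nth (taylor X i x (g a c) * taylor X i x (\<lambda>y. f i i x y $$ (c, a))) 1)
        = (\<Sum>a<r. \<Sum>c<r. if c = a then fps_nth (taylor X i x d) 1 else 0)"
    proof (intro sum.cong refl)
      fix a c assume "a \<in> {..<r}" "c \<in> {..<r}"
      then have ac: "a < r" "c < r" by auto
      show "fps_nth (taylor X i x (g a c) * taylor X i x (\<lambda>y. f i i x y $$ (c, a))) 1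
          = (if c = a then fps_nth (taylor X i x d) 1 else 0)"
        unfolding fps_mult_nth_1 taylor_nth_0[OF ix] g(3,4)[OF ac] f(3,4)[OF ac(2,1)]
        by (auto simp: algebra_simps)
    qed
    then show ?thesis using r by (simp add: taylor_\<beta> fps_sum_nth del: One_nat_def)
  qed
  ultimately show ?thesis using that \<beta>_holo by blast
qed

section \<open>The two leading coefficients of the operator\<close>

lemma fps_power_nth_1:
  fixes F :: "complex fps"
  shows "fps_nth (F ^ Suc m) 1 = of_nat (Suc m) * fps_nth F 0 ^ m * fps_nth F 1"
proof (induction m)
  case (Suc m)
  have "fps_nth (F ^ Suc (Suc m)) 1 = fps_nth F 0 * fps_nth (F ^ Suc m) 1 + fps_nth F 1 * fps_nth (F ^ Suc m) 0"
    by (simp only: power_Suc[of F "Suc m"] fps_mult_nth_1)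
  also have "\<dots> = of_nat (Suc (Suc m)) * fps_nth F 0 ^ Suc m * fps_nth F 1"
    unfolding Suc.IH by (simp add: fps_power_zeroth algebra_simps)
  finally show ?case .
qed simp

text \<open>
  Evaluated on \<open>(w - z)\<^sup>k\<close>, the pole of order \<open>n + 1\<close> of the kernel is reduced to order \<open>n + 1 - k\<close>.
\<close>

lemma beta_operator_index:
  assumes rho: "is_beta_operator X l \<theta> n B \<rho>" and ix: "i \<in> Idx X" "x \<in> Dom X i"
    and th: "holo_at X i x (\<theta> i)"
    and \<beta>: "holo_at X i x \<beta>" "\<forall>\<^sub>F y in at x. (crd X i y - crd X i x) * B i i x y = \<beta> y"
    and k: "k \<le> n"
  shows "\<rho> i x $$ (0, k) = fps_nth (taylor X i x \<beta> ^ (n + 1) * taylor X i x (\<theta> i)) (n - k)"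
proof -
  define h where "h = (\<lambda>y. \<beta> y ^ (n + 1) * \<theta> i y)"
  have h: "holo_at X i x h"
    unfolding h_def using th \<beta>(1) by (intro taylor_mult taylor_power)
  have "\<rho> i x \<in> carrier_mat 1 (n + 1)"
    using rho ix unfolding is_beta_operator_def bundle_hom_def by blast
  from mult_jet_crd_power[OF ix this _ k, of 0]
  have "\<rho> i x $$ (0, k) = vec_index (\<rho> i x *\<^sub>v jet X i n 1 (crd_power i x k) x) 0" by simp
  also have "\<dots> = residue_pairing X i (\<lambda>x y. (B i i x y) ^ (n + 1) * \<theta> i y)
      (\<lambda>y. vec_index (crd_power i x k y) 0) x"
    using rho ix local_section_crd_power[OF ix(1), of x k] unfolding is_beta_operator_def by blast
  also have "\<dots> = fps_nth (taylor X i x h) (n - k)"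
  proof (rule residue_pairing_taylor[OF ix h])
    show "\<forall>\<^sub>F y in at x. (crd X i y - crd X i x) ^ Suc (n - k) *
        ((B i i x y) ^ (n + 1) * \<theta> i y * vec_index (crd_power i x k y) 0) = h y"
      using \<beta>(2)
    proof eventually_elim
      case (elim y)
      let ?z = "crd X i y - crd X i x"
      have "?z ^ Suc (n - k) * ((B i i x y) ^ (n + 1) * \<theta> i y * ?z ^ k)
          = ?z ^ (Suc (n - k) + k) * (B i i x y) ^ (n + 1) * \<theta> i y"
        unfolding power_add by (simp only: mult_ac)
      also have "Suc (n - k) + k = n + 1" using k by simp
      finally show ?case
        unfolding h_def elim[symmetric] power_mult_distrib by (simp add: crd_power_def)
    qed
  qed
  also have "taylor X i x h = taylor X i x \<beta> ^ (n + 1) * taylor X i x (\<theta> i)"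
    unfolding h_def using th \<beta>(1) by (simp only: taylor_mult taylor_power)
  finally show ?thesis .
qed

text \<open>
  With \<open>b = 1 / \<theta>\<close> and \<open>b' = - \<theta>' / (2 \<theta>\<^sup>2)\<close>, the expansion of \<open>(b + b' (w - z))\<^bsup>n+1\<^esup> (\<theta> + \<theta>' (w - z))\<close>
  has the quotient \<open>\<theta>' / \<theta> - (n + 1) \<theta>' / (2 \<theta>) = - (n - 1) \<theta>' / (2 \<theta>)\<close> of its first two
  coefficients.
\<close>

lemma beta_operator_leading_terms:
  assumes theta: "theta_char X l \<theta>" and rho: "is_beta_operator X l \<theta> n B \<rho>" and n: "n \<ge> 1"
    and ix: "i \<in> Idx X" "x \<in> Dom X i"
    and \<beta>: "holo_at X i x \<beta>" "\<forall>\<^sub>F y in at x. (crd X i y - crd X i x) * B i i x y = \<beta> y"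
      "\<theta> i x * \<beta> x = 1"
      "2 * \<theta> i x * fps_nth (taylor X i x \<beta>) 1 + fps_nth (taylor X i x (\<theta> i)) 1 * \<beta> x = 0"
  shows "\<rho> i x $$ (0, n) \<noteq> 0"
    and "2 * \<rho> i x $$ (0, n - 1) * \<theta> i x
      = - of_nat (n - 1) * \<rho> i x $$ (0, n) * fps_nth (taylor X i x (\<theta> i)) 1"
proof -
  define t t' b b' where "t = \<theta> i x" and "t' = fps_nth (taylor X i x (\<theta> i)) 1"
    and "b = \<beta> x" and "b' = fps_nth (taylor X i x \<beta>) 1"
  have th: "holo_at X i x (\<theta> i)"
    using holo_on_imp_holo_at[OF ix(1) ix(2,2) chart(1)[OF ix(1)] theta_char_holo[OF theta ix(1)]] .
  note rho_index = beta_operator_index[where \<theta> = \<theta>, OF rho ix th \<beta>(1,2)]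
  have rho_n: "\<rho> i x $$ (0, n) = b ^ (n + 1) * t"
    using rho_index[of n] by (simp add: taylor_nth_0[OF ix] fps_power_zeroth t_def b_def)
  have "\<rho> i x $$ (0, n - 1) = fps_nth (taylor X i x \<beta> ^ Suc n * taylor X i x (\<theta> i)) 1"
    using rho_index[of "n - 1"] n by simp
  also have "\<dots> = b ^ (n + 1) * t' + of_nat (n + 1) * b ^ n * b' * t"
    by (simp only: fps_mult_nth_1 fps_power_nth_1 fps_power_zeroth taylor_nth_0[OF ix])
      (simp add: t_def t'_def b_def b'_def)
  finally have rho_n1: "\<rho> i x $$ (0, n - 1) = b ^ (n + 1) * t' + of_nat (n + 1) * b ^ n * b' * t" .
  have tb: "t * b = 1" and b': "2 * t * b' = - (t' * b)"
    using \<beta>(3,4) by (simp_all add: t_def t'_def b_def b'_def eq_neg_iff_add_eq_0)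
  show "\<rho> i x $$ (0, n) \<noteq> 0"
    using tb unfolding rho_n by auto
  have "2 * \<rho> i x $$ (0, n - 1) * t = t * (2 * b ^ (n + 1) * t' + of_nat (n + 1) * b ^ n * (2 * t * b'))"
    unfolding rho_n1 by (simp add: algebra_simps)
  also have "\<dots> = - of_nat (n - 1) * (b ^ (n + 1) * t) * t'"
    unfolding b' using n by (simp add: algebra_simps of_nat_diff)
  finally show "2 * \<rho> i x $$ (0, n - 1) * \<theta> i x
      = - of_nat (n - 1) * \<rho> i x $$ (0, n) * fps_nth (taylor X i x (\<theta> i)) 1"
    unfolding rho_n by (simp add: t_def t'_def)
qed

end

section \<open>The induced connection on the determinant\<close>

theorem proposition4p3:
  fixes X :: "('a::t2_space, 'i) rsurface"
    and g r n :: nat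
    and l :: "('a, 'i) line_cocycle" and \<theta> :: "'i \<Rightarrow> 'a \<Rightarrow> complex"
    and E :: "('a, 'i) vbundle"
    and A f :: "'i \<Rightarrow> 'i \<Rightarrow> 'a \<Rightarrow> 'a \<Rightarrow> complex mat"
    and \<delta> :: "'i \<Rightarrow> 'a \<Rightarrow> 'a \<Rightarrow> complex"
    and \<Phi> :: "'i \<Rightarrow> 'a \<Rightarrow> 'a \<Rightarrow> complex mat"
    and U :: "('a \<times> 'a) set"
    and DE \<rho> D1 h D C :: "'i \<Rightarrow> 'a \<Rightarrow> complex mat"
  assumes "compact_riemann_surface X" and "has_genus X g" and "g \<ge> 2"
    and "theta_char X l \<theta>"
    and "r \<ge> 1" and "n \<ge> 2"
    and "in_moduli X l r E"
    and "is_A X l \<theta> r E A"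
    and "is_delta X l \<theta> \<delta>"
    and "is_Phi X r E A \<delta> \<Phi>"
    and "is_DE X r E \<Phi> DE"
    and "tubular_nbhd U"
    and "is_parallel_iso X r E DE U f"
    and "is_beta_operator X l \<theta> n (beta_hat r A f) \<rho>"
    and "is_D1 X n (lpow l (1 - int n)) \<rho> D1"
    and "is_jet_embedding X n (lpow l (1 - int n)) h"
    and "is_DD X n (lpow l (1 - int n)) (\<lambda>i x. h i x * D1 i x) D"
    and "induced_det_connection X n D C"
  shows "trivial_connection X (det_bundle (jet_bundle X (n - 1) 1 (lpow l (1 - int n)))) C"
proof -
  interpret riemann_charts X
    using assms(1) by unfold_locales (simp add: compact_riemann_surface_def)
  note theta = assms(4) and n = \<open>n \<ge> 2\<close>
  define N where "N = (\<Sum>q<n. q)"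
  show ?thesis
  proof (rule trivial_connection_if_flat_frame[where u = "\<lambda>i x. \<theta> i x ^ N"])
    fix i assume i: "i \<in> Idx X"
    show "holo_on X (Dom X i) (\<lambda>x. \<theta> i x ^ N)"
      using theta_char_holo[OF theta i] unfolding holo_on_def o_def by (auto intro!: holomorphic_intros)
    fix x assume x: "x \<in> Dom X i"
    note ix = i x
    show "\<theta> i x ^ N \<noteq> 0" using theta_char_nonzero[OF theta ix] by simp
    show "C i x \<in> carrier_mat 1 2"
      using assms(18) ix by (simp add: induced_det_connection_def)
    have D: "D i x \<in> carrier_mat n (2 * n)" "D i x * (h i x * D1 i x) = 0\<^sub>m n n"
      "D i x * jet_incl 1 n = 1\<^sub>m n"
      using assms(17) ix unfolding is_DD_def bundle_hom_def by blast+
    have D1: "D1 i x \<in> carrier_mat (n + 1) n" "\<rho> i x * D1 i x = 0\<^sub>m 1 n" "jet_trunc n 1 * D1 i x = 1\<^sub>m n"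
      using assms(15) ix unfolding is_D1_def bundle_hom_def by blast+
    have h: "h i x \<in> carrier_mat (2 * n) (n + 1)"
      using assms(16) ix unfolding is_jet_embedding_def bundle_hom_def by blast
    have \<rho>: "\<rho> i x \<in> carrier_mat 1 (n + 1)"
      using assms(14) ix unfolding is_beta_operator_def bundle_hom_def by blast
    have n0: "n > 0" "n \<ge> 1" using n by auto
    note C = induced_det_connection_index[OF n0(1) ix D(1,3) assms(18)]
    show "C i x $$ (0, 1) = 1" by (rule C(2))
    obtain d where d: "holo_at X i x d"
      "\<forall>\<^sub>F y in at x. (crd X i y - crd X i x) * \<delta> i x y = d y" "\<theta> i x * d x = 1"
      "2 * \<theta> i x * fps_nth (taylor X i x d) 1 + fps_nth (taylor X i x (\<theta> i)) 1 * d x = 0"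
      using delta_expansion[OF theta assms(9) ix] .
    obtain \<beta> where \<beta>: "holo_at X i x \<beta>"
      "\<forall>\<^sub>F y in at x. (crd X i y - crd X i x) * beta_hat r A f i i x y = \<beta> y"
      "\<beta> x = d x" "fps_nth (taylor X i x \<beta>) 1 = fps_nth (taylor X i x d) 1"
      using beta_hat_expansion[OF theta assms(5,8,10,11,12,13) ix d(1-3)] .
    note lead = beta_operator_leading_terms[OF theta assms(14) n0(2) ix \<beta>(1,2), unfolded \<beta>(3,4), OF d(3,4)]
    \<comment> \<open>the trace of the connection matrix in terms of the logarithmic derivative of \<open>\<theta>\<close>\<close>
    have "C i x $$ (0, 0) = of_nat n * \<rho> i x $$ (0, n - 1) / \<rho> i x $$ (0, n)"
      unfolding C(1) using jet_embedding_index[OF assms(16) ix]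
      by (intro companion_trace[OF n0(1) \<rho> D1(1) h D(1) D1(2,3) _ _ D(2,3) lead(1)])
    then have "2 * (C i x $$ (0, 0) * \<theta> i x) * \<rho> i x $$ (0, n)
        = of_nat n * (2 * \<rho> i x $$ (0, n - 1) * \<theta> i x)"
      using lead(1) by simp
    also have "\<dots> = - of_nat (n * (n - 1)) * fps_nth (taylor X i x (\<theta> i)) 1 * \<rho> i x $$ (0, n)"
      unfolding lead(2) by simp
    also have "n * (n - 1) = 2 * N"
      by (simp add: N_def sum_lessThan_eq_triangular)
    finally have "(C i x $$ (0, 0) * \<theta> i x) * (2 * \<rho> i x $$ (0, n))
        = (- of_nat N * fps_nth (taylor X i x (\<theta> i)) 1) * (2 * \<rho> i x $$ (0, n))"
      by (simp add: mult_ac)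
    then have C00: "C i x $$ (0, 0) * \<theta> i x = - of_nat N * fps_nth (taylor X i x (\<theta> i)) 1"
      using lead(1) by (subst (asm) mult_right_cancel) simp_all
    have th: "holo_at X i x (\<theta> i)"
      using holo_on_imp_holo_at[OF i x x chart(1)[OF i] theta_char_holo[OF theta i]] .
    show "C i x $$ (0, 0) * \<theta> i x ^ N + tcoeff X i x 1 (\<lambda>y. \<theta> i y ^ N) = 0"
    proof (cases N)
      case 0
      then show ?thesis using C00 theta_char_nonzero[OF theta ix] by (simp add: tcoeff_eq_taylor taylor_const)
    next
      case (Suc m)
      have "C i x $$ (0, 0) * \<theta> i x ^ N = (C i x $$ (0, 0) * \<theta> i x) * \<theta> i x ^ m"
        by (simp add: Suc)
      moreover have "tcoeff X i x 1 (\<lambda>y. \<theta> i y ^ N) = of_nat N * \<theta> i x ^ m * fps_nth (taylor X i x (\<theta> i)) 1"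
        unfolding tcoeff_eq_taylor taylor_power(1)[OF th] Suc fps_power_nth_1 taylor_nth_0[OF ix] ..
      ultimately show ?thesis unfolding C00 by simp
    qed
  next
    fix i j x assume "i \<in> Idx X" "j \<in> Idx X" "x \<in> Dom X i \<inter> Dom X j"
    then show "det_bundle (jet_bundle X (n - 1) 1 (lpow l (1 - int n))) i j x = scalar (\<theta> i x ^ N / \<theta> j x ^ N)"
      using det_jet_bundle_theta_char[OF theta, of n i j x] n
      by (simp add: det_bundle_def N_def power_divide)
  qed
qed

end
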